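(* Let $d\ge 3$ and let $Q$ be a probability measure on $\Omega=\{0,1\}^{\mathbb{Z}^d}$ such that (1) $Q$ is stationary and ergodic with respect to each of the shifts $\theta_{e_1},\dots,\theta_{e_d}$, and (2) $Q(\mathcal{P}(\omega)=\emptyset)<1$. Then the random walk $(X_n)_{n\ge0}$ on the discrete point process is $\mathbb{P}$-almost surely transient, where $\mathbb{P}$ is the annealed law.
   Context: Setting. $\Omega=\{0,1\}^{\mathbb{Z}^d}$ carries its product Borel $\sigma$-algebra. For $x\in\mathbb{Z}^d$, $(\theta_x\omega)(y)=\omega(x+y)$. $e_1,\dots,e_d$ are the standard unit vectors and $\mathcal{E}=\{\pm e_i\}_{i=1}^d$. $\mathcal{P}(\omega)=\{x\in\mathbb{Z}^d:\omega(x)=1\}$. $\Omega_0=\{\omega:\omega(0)=1\}$; under (1),(2) one has $Q(\Omega_0)>0$, and $P(\cdot)=Q(\cdot\mid\Omega_0)$. For $e\in\mathcal{E}$, $f_e(\omega)=\min\{k>0:\omega(ke)=1\}$ (for $Q$-a.e. $\omega$, $f_e(\theta_v\omega)<\infty$ for all $v,e$). The coordinate nearest neighbors of $v$ are $N_v(\omega)=\{v+f_e(\theta_v\omega)e:e\in\mathcal{E}\}$. For $P$-a.e. $\omega\in\Omega_0$, $P_\omega$ (quenched law) is the law of the Markov chain $(X_n)_{n\ge0}$ on $\mathcal{P}(\omega)$ with $P_\omega(X_0=0)=1$ and $P_\omega(X_{n+1}=u\mid X_n=v)=\frac1{2d}$ if $u\in N_v(\omega)$ and $0$ otherwise. The annealed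 law is $\mathbb{P}(G)=\int P_\omega(G)\,P(d\omega)$. Transient means that each point is visited only finitely many times. *)

theory Defs
  imports "HOL-Probability.Probability"
begin

type_synonym 'd site = "int ^ 'd"

text \<open>\<^term>\<open>True\<close> stands for the value 1 of a configuration in \<open>{0,1}^(Z^d)\<close>, where
  \<open>d = CARD('d)\<close>.\<close>

type_synonym 'd config = "'d site \<Rightarrow> bool"

type_synonym 'd path = "nat \<Rightarrow> 'd site"

abbreviation config_space :: "('d::finite) config measure" where
  "config_space \<equiv> \<Pi>\<^sub>M x\<in>UNIV. count_space UNIV"

abbreviation path_space :: "('d::finite) path measure" where
  "path_space \<equiv> \<Pi>\<^sub>M n\<in>UNIV. count_space UNIV"

definition unit_vec :: "'d \<Rightarrow> ('d::finite) site" where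
  "unit_vec i = axis i 1"

definition dirs :: "('d::finite) site set" where
  "dirs = range unit_vec \<union> uminus ` range unit_vec"

definition shift :: "('d::finite) site \<Rightarrow> 'd config \<Rightarrow> 'd config" where
  "shift x \<omega> = (\<lambda>y. \<omega> (x + y))"

definition points :: "('d::finite) config \<Rightarrow> 'd site set" where
  "points \<omega> = {x. \<omega> x}"

definition origin_occupied :: "('d::finite) config set" where
  "origin_occupied = {\<omega>. \<omega> 0}"

definition stationary :: "'a measure \<Rightarrow> ('a \<Rightarrow> 'a) \<Rightarrow> bool" where
  "stationary M T \<longleftrightarrow> T \<in> measurable M M \<and> distr M M T = M"

definition ergodic :: "'a measure \<Rightarrow> ('a \<Rightarrow> 'a) \<Rightarrow> bool" where
  "ergodic M T \<longleftrightarrow>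
     (\<forall>A \<in> sets M. T -` A \<inter> space M = A \<longrightarrow> measure M A = 0 \<or> measure M A = 1)"

definition conditioned :: "('d::finite) config measure \<Rightarrow> 'd config measure" where
  "conditioned Q = uniform_measure Q origin_occupied"

text \<open>If no site \<open>k e\<close> with \<open>k > 0\<close> is occupied, \<open>first_dist\<close> is an unspecified number; this
  happens only on a \<open>Q\<close>-null set.\<close>

definition first_dist :: "('d::finite) config \<Rightarrow> 'd site \<Rightarrow> nat" where
  "first_dist \<omega> e = (LEAST k. k > 0 \<and> \<omega> (int k *s e))"

definition nbrs :: "('d::finite) config \<Rightarrow> 'd site \<Rightarrow> 'd site set" where
  "nbrs \<omega> v = {v + int (first_dist (shift v \<omega>) e) *s e | e. e \<in> dirs}"

definition transition_prob :: "('d::finite) config \<Rightarrow> 'd site \<Rightarrow> 'd site \<Rightarrow> real" where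
  "transition_prob \<omega> v u = (if u \<in> nbrs \<omega> v then 1 / (2 * real CARD('d)) else 0)"

definition is_quenched_law :: "('d::finite) config \<Rightarrow> 'd path measure \<Rightarrow> bool" where
  "is_quenched_law \<omega> \<mu> \<longleftrightarrow>
     prob_space \<mu> \<and> sets \<mu> = sets path_space \<and>
     (AE X in \<mu>. \<forall>n. X n \<in> points \<omega>) \<and>
     \<P>(X in \<mu>. X 0 = 0) = 1 \<and>
     (\<forall>n x u. \<P>(X in \<mu>. \<forall>i\<le>n. X i = x i) > 0 \<longrightarrow>
        \<P>(X in \<mu>. X (Suc n) = u \<bar> \<forall>i\<le>n. X i = x i) = transition_prob \<omega> (x n) u)"

definition quenched_law :: "('d::finite) config \<Rightarrow> 'd path measure" where
  "quenched_law \<omega> = (THE \<mu>. is_quenched_law \<omega> \<mu>)"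

text \<open>The set function below is a measure because \<open>quenched_law\<close> is well defined and measurable
  in the configuration almost surely; see \<open>ex1_quenched_law\<close> and \<open>emeasure_annealed_law\<close>.\<close>

definition annealed_law :: "('d::finite) config measure \<Rightarrow> 'd path measure" where
  "annealed_law Q = measure_of UNIV (sets path_space)
     (\<lambda>G. \<integral>\<^sup>+\<omega>. emeasure (quenched_law \<omega>) G \<partial>conditioned Q)"

definition transient :: "('d::finite) path \<Rightarrow> bool" where
  "transient X \<longleftrightarrow> (\<forall>v. finite {n. X n = v})"

subsection \<open>Well-definedness of the quenched and the annealed law\<close>

definition line_recurrent :: "('d::finite) config \<Rightarrow> bool" where
  "line_recurrent \<omega> \<longleftrightarrow> (\<forall>v. \<forall>e\<in>dirs. \<exists>k>0. \<omega> (v + int k *s e))"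

definition step :: "('d::finite) config \<Rightarrow> 'd site \<Rightarrow> 'd site \<Rightarrow> 'd site" where
  "step \<omega> v e = v + int (first_dist (shift v \<omega>) e) *s e"

lemma nbrs_eq_step: "nbrs \<omega> v = step \<omega> v ` dirs"
  by (auto simp: nbrs_def step_def)

lemma finite_dirs [simp]: "finite (dirs :: ('d::finite) site set)"
  by (simp add: dirs_def)

lemma dirs_nonempty [simp]: "(dirs :: ('d::finite) site set) \<noteq> {}"
  by (simp add: dirs_def)

lemma axis_neq_uminus_axis: "axis i (1::int) \<noteq> - axis (j::'d::finite) 1"
proof
  assume "axis i (1::int) = - axis j 1"
  then have "axis i (1::int) $ i = (- axis j 1) $ i" by simp
  then show False by (simp add: axis_def split: if_splits)
qed

lemma inj_unit_vec: "inj (unit_vec :: 'd \<Rightarrow> ('d::finite) site)"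
  by (auto simp: inj_def unit_vec_def axis_eq_axis)

lemma card_dirs: "card (dirs :: ('d::finite) site set) = 2 * CARD('d)"
proof -
  have "range unit_vec \<inter> uminus ` range unit_vec = ({} :: 'd site set)"
    using axis_neq_uminus_axis by (auto simp: unit_vec_def)
  then show ?thesis
    unfolding dirs_def
    by (subst card_Un_disjoint) (auto simp: card_image inj_unit_vec)
qed

lemma first_dist_pos:
  assumes "line_recurrent \<omega>" "e \<in> dirs"
  shows "first_dist (shift v \<omega>) e > 0 \<and> \<omega> (v + int (first_dist (shift v \<omega>) e) *s e)"
proof -
  obtain k where "k > 0 \<and> shift v \<omega> (int k *s e)"
    using assms by (auto simp: line_recurrent_def shift_def)
  from LeastI[of "\<lambda>k. k > 0 \<and> shift v \<omega> (int k *s e)", OF this]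
  show ?thesis by (simp add: first_dist_def shift_def)
qed

lemma step_in_points: "line_recurrent \<omega> \<Longrightarrow> e \<in> dirs \<Longrightarrow> step \<omega> v e \<in> points \<omega>"
  using first_dist_pos by (auto simp: points_def step_def)

lemma scaled_dirs_inj:
  fixes e e' :: "('d::finite) site"
  assumes "e \<in> dirs" "e' \<in> dirs" "k > 0" "l > 0" "int k *s e = int l *s e'"
  shows "e = e'"
proof -
  obtain i s where e: "e = s *s axis i 1" "s = 1 \<or> s = (-1::int)"
    using assms(1) by (auto simp: dirs_def unit_vec_def)
      (metis vector_smult_lid, metis vector_sneg_minus1)
  obtain j t where e': "e' = t *s axis j 1" "t = 1 \<or> t = (-1::int)"
    using assms(2) by (auto simp: dirs_def unit_vec_def)
      (metis vector_smult_lid, metis vector_sneg_minus1)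
  have "(int k *s e) $ i = (int l *s e') $ i" using assms(5) by simp
  then have eq: "int k * s = int l * (t * (if i = j then 1 else 0))"
    by (simp add: e e' axis_def)
  with assms e have ij: "i = j" by (auto split: if_splits)
  with eq assms e e' have "s = t" by auto
  with ij e e' show ?thesis by simp
qed

lemma inj_on_step: "line_recurrent \<omega> \<Longrightarrow> inj_on (step \<omega> v) dirs"
  proof (rule inj_onI)
  fix e e' :: "'a site"
  assume "line_recurrent \<omega>" "e \<in> dirs" "e' \<in> dirs" "step \<omega> v e = step \<omega> v e'"
  then show "e = e'"
    using first_dist_pos[of \<omega> e v] first_dist_pos[of \<omega> e' v]
    by (intro scaled_dirs_inj[of e e' "first_dist (shift v \<omega>) e" "first_dist (shift v \<omega>) e'"])
      (simp_all add: step_def)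
qed

text \<open>The walk driven by a sequence of directions; with independent uniform directions it has
  the quenched law.\<close>

primrec walk :: "('d::finite) config \<Rightarrow> 'd path \<Rightarrow> nat \<Rightarrow> 'd site" where
  "walk \<omega> \<xi> 0 = 0"
| "walk \<omega> \<xi> (Suc n) = step \<omega> (walk \<omega> \<xi> n) (\<xi> n)"

definition driving :: "('d::finite) path measure" where
  "driving = (\<Pi>\<^sub>M n\<in>UNIV. measure_pmf (pmf_of_set dirs))"

lemma sets_driving [measurable_cong]: "sets driving = sets path_space"
  unfolding driving_def by (intro sets_PiM_cong) auto

lemma space_driving [simp]: "space driving = UNIV"
  by (simp add: driving_def space_PiM)

lemma prob_space_driving: "prob_space driving"
  unfolding driving_def by (intro prob_space_PiM) (rule prob_space_measure_pmf)

lemma measurable_step [measurable]: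
  "(\<lambda>\<omega>. step \<omega> v e) \<in> measurable config_space (count_space UNIV)"
  unfolding step_def first_dist_def shift_def by measurable

lemma measurable_walk [measurable]:
  "(\<lambda>(\<omega>, \<xi>). walk \<omega> \<xi> n)
     \<in> measurable ((config_space :: ('d::finite) config measure) \<Otimes>\<^sub>M path_space) (count_space UNIV)"
proof (induction n)
  case (Suc n)
  have [measurable]: "(\<lambda>p. walk (fst p) (snd p) n)
      \<in> measurable ((config_space :: 'd config measure) \<Otimes>\<^sub>M path_space) (count_space UNIV)"
    using Suc by (simp add: case_prod_beta')
  have "(\<lambda>p. (\<lambda>v. (\<lambda>e. step (fst p) v e) (snd p n)) (walk (fst p) (snd p) n))
      \<in> measurable ((config_space :: 'd config measure) \<Otimes>\<^sub>M path_space) (count_space UNIV)"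
    by (rule measurable_compose_countable, rule measurable_compose_countable) measurable
  then show ?case by (simp add: case_prod_beta')
qed simp

lemma measurable_walk_path:
  "(\<lambda>(\<omega>, \<xi>). walk \<omega> \<xi>) \<in> measurable (config_space \<Otimes>\<^sub>M path_space) path_space"
  using measurable_walk
  by (intro measurable_PiM_single') (auto simp: case_prod_beta' space_PiM)

lemma measurable_walk_snd [measurable]: "walk \<omega> \<in> measurable path_space path_space"
proof -
  have "(\<lambda>\<xi>. (\<omega>, \<xi>)) \<in> measurable path_space (config_space \<Otimes>\<^sub>M path_space)"
    by (rule measurable_Pair1') (simp add: space_PiM)
  from measurable_compose[OF this measurable_walk_path] show ?thesis by simp
qed

definition walk_law :: "('d::finite) config \<Rightarrow> 'd path measure" where
  "walk_law \<omega> = distr driving path_space (walk \<omega>)"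

lemma sets_walk_law [measurable_cong, simp]: "sets (walk_law \<omega>) = sets path_space"
  by (simp add: walk_law_def)

lemma space_walk_law [simp]: "space (walk_law \<omega>) = UNIV"
  by (simp add: walk_law_def space_PiM)

lemma measurable_walk_driving [measurable]: "walk \<omega> \<in> measurable driving path_space"
  using measurable_walk_snd by (simp cong: measurable_cong_sets add: sets_driving)

lemma prob_space_walk_law: "prob_space (walk_law \<omega>)"
  unfolding walk_law_def by (intro prob_space.prob_space_distr prob_space_driving) measurable

lemma AE_driving_dirs: "AE \<xi> in driving. \<forall>n. \<xi> n \<in> (dirs :: ('d::finite) site set)"
proof -
  have "AE \<xi> in (driving :: 'd path measure). \<xi> n \<in> dirs" for n
    unfolding driving_def
  proof (rule AE_PiM_component)
    show "AE e in measure_pmf (pmf_of_set (dirs :: 'd site set)). e \<in> dirs"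
      by (simp add: AE_measure_pmf_iff)
  qed (auto intro: prob_space_measure_pmf)
  then show ?thesis by (simp add: AE_all_countable)
qed

lemma measure_driving_prefix:
  assumes "\<And>i. i < n \<Longrightarrow> e i \<in> (dirs :: ('d::finite) site set)"
  shows "measure driving {\<xi>. \<forall>i<n. \<xi> i = e i} = (1 / (2 * real CARD('d))) ^ n"
proof -
  have "{\<xi>. \<forall>i<n. \<xi> i = e i} =
      prod_emb UNIV (\<lambda>_. measure_pmf (pmf_of_set (dirs :: 'd site set))) {..<n} (Pi\<^sub>E {..<n} (\<lambda>i. {e i}))"
    by (auto simp: prod_emb_def space_PiM PiE_def Pi_def)
  moreover have "product_prob_space (\<lambda>_::nat. measure_pmf (pmf_of_set (dirs :: 'd site set)))"
    by (intro product_prob_spaceI prob_space_measure_pmf)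
  ultimately have "measure driving {\<xi>. \<forall>i<n. \<xi> i = e i} =
      (\<Prod>i<n. measure (measure_pmf (pmf_of_set (dirs :: 'd site set))) {e i})"
    unfolding driving_def by (simp add: product_prob_space.measure_PiM_emb)
  also have "\<dots> = (\<Prod>i<n. 1 / (2 * real CARD('d)))"
    using assms by (intro prod.cong) (auto simp: measure_pmf_single card_dirs)
  finally show ?thesis by simp
qed

lemma walk_prefix_iff:
  assumes "line_recurrent \<omega>" "\<And>i. i < n \<Longrightarrow> e i \<in> dirs" "\<And>i. \<xi> i \<in> dirs"
    and "x 0 = 0" "\<And>i. i < n \<Longrightarrow> x (Suc i) = step \<omega> (x i) (e i)"
  shows "(\<forall>i\<le>n. walk \<omega> \<xi> i = x i) \<longleftrightarrow> (\<forall>i<n. \<xi> i = e i)"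
  using assms(2,5)
proof (induction n)
  case (Suc n)
  then have IH: "(\<forall>i\<le>n. walk \<omega> \<xi> i = x i) \<longleftrightarrow> (\<forall>i<n. \<xi> i = e i)" by simp
  have "step \<omega> (x n) (\<xi> n) = step \<omega> (x n) (e n) \<longleftrightarrow> \<xi> n = e n"
    using inj_on_step[OF assms(1)] assms(3) Suc.prems(1) by (auto simp: inj_on_def)
  then have "walk \<omega> \<xi> n = x n \<Longrightarrow> walk \<omega> \<xi> (Suc n) = x (Suc n) \<longleftrightarrow> \<xi> n = e n"
    using Suc.prems(2)[of n] by simp
  then show ?case using IH by (auto simp: le_Suc_eq less_Suc_eq)
qed (use assms in auto)

lemma walk_law_prefix:
  fixes \<omega> :: "('d::finite) config"
  assumes "line_recurrent \<omega>"
  shows "measure (walk_law \<omega>) {X. \<forall>i\<le>n. X i = x i} =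
    (if x 0 = 0 then \<Prod>i<n. transition_prob \<omega> (x i) (x (Suc i)) else 0)"
proof -
  interpret D: prob_space "driving :: 'd path measure" by (rule prob_space_driving)
  have "{X \<in> space path_space. \<forall>i\<le>n. X i = x i} \<in> sets path_space" by measurable
  then have S: "{X. \<forall>i\<le>n. X i = x i} \<in> sets path_space" by (simp add: space_PiM)
  have W: "{\<xi>. \<forall>i\<le>n. walk \<omega> \<xi> i = x i} \<in> sets driving"
    using measurable_sets[OF measurable_walk_driving[of \<omega>] S] by (simp add: vimage_def)
  have eq: "measure (walk_law \<omega>) {X. \<forall>i\<le>n. X i = x i} =
      measure driving {\<xi>. \<forall>i\<le>n. walk \<omega> \<xi> i = x i}"
    unfolding walk_law_def using S by (subst measure_distr) (auto simp: vimage_def)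
  show ?thesis
  proof (cases "x 0 = 0 \<and> (\<forall>i<n. x (Suc i) \<in> nbrs \<omega> (x i))")
    case True
    then have "\<forall>i. \<exists>e. i < n \<longrightarrow> e \<in> dirs \<and> x (Suc i) = step \<omega> (x i) e"
      by (auto simp: nbrs_eq_step)
    then obtain e where e: "\<And>i. i < n \<Longrightarrow> e i \<in> dirs \<and> x (Suc i) = step \<omega> (x i) (e i)"
      by metis
    have S2: "{\<xi>. \<forall>i<n. \<xi> i = e i} \<in> sets driving"
    proof -
      have "{\<xi> \<in> space path_space. \<forall>i<n. \<xi> i = e i} \<in> sets path_space" by measurable
      then show ?thesis by (simp add: space_PiM sets_driving)
    qed
    have "AE \<xi> in driving. \<xi> \<in> {\<xi>. \<forall>i\<le>n. walk \<omega> \<xi> i = x i} \<longleftrightarrow> \<xi> \<in> {\<xi>. \<forall>i<n. \<xi> i = e i}"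
      using AE_driving_dirs
    proof eventually_elim
      case (elim \<xi>)
      with walk_prefix_iff[OF assms, of n e \<xi> x] e True show ?case by auto
    qed
    then have "measure driving {\<xi>. \<forall>i\<le>n. walk \<omega> \<xi> i = x i} = measure driving {\<xi>. \<forall>i<n. \<xi> i = e i}"
      using W S2 by (intro D.finite_measure_eq_AE) auto
    also have "\<dots> = (1 / (2 * real CARD('d))) ^ n"
      using e by (intro measure_driving_prefix) auto
    finally show ?thesis using True eq by (simp add: transition_prob_def)
  next
    case False
    have "AE \<xi> in driving. \<xi> \<notin> {\<xi>. \<forall>i\<le>n. walk \<omega> \<xi> i = x i}"
      using AE_driving_dirs
    proof eventually_elim
      case (elim \<xi>)
      show ?case
      proof
        assume "\<xi> \<in> {\<xi>. \<forall>i\<le>n. walk \<omega> \<xi> i = x i}"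
        then have w: "\<And>i. i \<le> n \<Longrightarrow> x i = walk \<omega> \<xi> i" by simp
        then have "x 0 = 0" by (metis le0 walk.simps(1))
        moreover have "x (Suc i) \<in> nbrs \<omega> (x i)" if "i < n" for i
          using w[of i] w[of "Suc i"] that elim by (auto simp: nbrs_eq_step)
        ultimately show False using False by blast
      qed
    qed
    then have "measure driving {\<xi>. \<forall>i\<le>n. walk \<omega> \<xi> i = x i} = 0"
      using W by (simp add: D.prob_eq_0)
    moreover have "x 0 = 0 \<Longrightarrow> (\<Prod>i<n. transition_prob \<omega> (x i) (x (Suc i))) = 0"
      using False by (auto simp: transition_prob_def)
    ultimately show ?thesis using eq by simp
  qed
qed

lemma prefix_Suc:
  "{X. X (Suc n) = u \<and> (\<forall>i\<le>n. X i = x i)} = {X. \<forall>i\<le>Suc n. X i = (x(Suc n := u)) i}"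
  by (auto simp: le_Suc_eq)

lemma is_quenched_law_walk_law:
  fixes \<omega> :: "('d::finite) config"
  assumes "line_recurrent \<omega>" "\<omega> 0"
  shows "is_quenched_law \<omega> (walk_law \<omega>)"
proof -
  have pts: "AE X in walk_law \<omega>. \<forall>n. X n \<in> points \<omega>"
    unfolding walk_law_def
  proof (subst AE_distr_iff)
    show "AE \<xi> in driving. \<forall>n. walk \<omega> \<xi> n \<in> points \<omega>"
      using AE_driving_dirs
    proof eventually_elim
      case (elim \<xi>)
      have "walk \<omega> \<xi> n \<in> points \<omega>" for n
      proof (cases n)
        case 0
        then show ?thesis using assms(2) by (simp add: points_def)
      next
        case (Suc m)
        then show ?thesis using step_in_points[OF assms(1)] elim by simp
      qed
      then show ?case by blast
    qed
  qed measurable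
  have "measure (walk_law \<omega>) {X. X 0 = 0} = 1"
    using walk_law_prefix[OF assms(1), of 0 "\<lambda>_. 0"] by simp
  moreover have "\<P>(X in walk_law \<omega>. X (Suc n) = u \<bar> \<forall>i\<le>n. X i = x i) = transition_prob \<omega> (x n) u"
    if "measure (walk_law \<omega>) {X. \<forall>i\<le>n. X i = x i} > 0" for n x u
    using that unfolding cond_prob_def
    by (simp add: prefix_Suc walk_law_prefix[OF assms(1)] del: prod_zero_iff split: if_splits)
  ultimately show ?thesis
    using pts prob_space_walk_law by (simp add: is_quenched_law_def)
qed

lemma is_quenched_law_prefix:
  fixes \<omega> :: "('d::finite) config"
  assumes "is_quenched_law \<omega> \<mu>"
  shows "measure \<mu> {X. \<forall>i\<le>n. X i = x i} =
    (if x 0 = 0 then \<Prod>i<n. transition_prob \<omega> (x i) (x (Suc i)) else 0)"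
proof -
  interpret prob_space \<mu> using assms by (simp add: is_quenched_law_def)
  have sets_\<mu> [measurable_cong]: "sets \<mu> = sets path_space"
    using assms by (simp add: is_quenched_law_def)
  have sp [simp]: "space \<mu> = UNIV"
    using sets_eq_imp_space_eq[OF sets_\<mu>] by (simp add: space_PiM)
  have S: "{X. X 0 = v} \<in> events" for v
  proof -
    have "{X \<in> space \<mu>. X 0 = v} \<in> events" by measurable
    then show ?thesis by simp
  qed
  have P: "{X. \<forall>i\<le>n. X i = x i} \<in> events" for n x
  proof -
    have "{X \<in> space \<mu>. \<forall>i\<le>n. X i = x i} \<in> events" by measurable
    then show ?thesis by simp
  qed
  have init: "prob {X. X 0 = 0} = 1"
    and trans: "\<And>n x u. prob {X. \<forall>i\<le>n. X i = x i} > 0 \<Longrightarrow>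
        prob {X. \<forall>i\<le>Suc n. X i = (x(Suc n := u)) i} / prob {X. \<forall>i\<le>n. X i = x i} =
        transition_prob \<omega> (x n) u"
    using assms unfolding is_quenched_law_def cond_prob_def by (auto simp: prefix_Suc)
  show ?thesis
  proof (induction n)
    case 0
    show ?case
    proof (cases "x 0 = 0")
      case False
      have "AE X in \<mu>. X 0 = 0" using init S[of 0] by (simp add: prob_eq_1)
      then have "AE X in \<mu>. X \<notin> {X. X 0 = x 0}" using False by auto
      then show ?thesis using False S[of "x 0"] by (simp add: prob_eq_0)
    qed (use init in auto)
  next
    case (Suc n)
    show ?case
    proof (cases "prob {X. \<forall>i\<le>n. X i = x i} > 0")
      case True
      have "(x(Suc n := x (Suc n))) = x" by simp
      with trans[OF True, of "x (Suc n)"] True Suc show ?thesis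
        by (auto simp: field_simps split: if_splits)
    next
      case False
      then have z: "prob {X. \<forall>i\<le>n. X i = x i} = 0"
        by (simp add: not_less measure_le_0_iff)
      moreover have "prob {X. \<forall>i\<le>Suc n. X i = x i} \<le> prob {X. \<forall>i\<le>n. X i = x i}"
        using P by (intro finite_measure_mono) auto
      ultimately have "prob {X. \<forall>i\<le>Suc n. X i = x i} = 0"
        using z by (simp add: measure_le_0_iff)
      with z Suc show ?thesis by (auto split: if_splits)
    qed
  qed
qed

lemma path_measure_eqI:
  fixes \<mu> \<nu> :: "('d::finite) path measure"
  assumes "prob_space \<mu>" "prob_space \<nu>"
    and sets_\<mu> [measurable_cong]: "sets \<mu> = sets path_space"
    and sets_\<nu> [measurable_cong]: "sets \<nu> = sets path_space"
    and eq: "\<And>n x. measure \<mu> {X. \<forall>i\<le>n. X i = x i} = measure \<nu> {X. \<forall>i\<le>n. X i = x i}"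
  shows "\<mu> = \<nu>"
proof -
  interpret M: prob_space \<mu> by fact
  interpret N: prob_space \<nu> by fact
  have sp [simp]: "space \<mu> = UNIV" "space \<nu> = UNIV"
    using sets_eq_imp_space_eq[OF sets_\<mu>] sets_eq_imp_space_eq[OF sets_\<nu>]
    by (simp_all add: space_PiM)
  define pre where "pre n X = restrict X {..n}" for n and X :: "'d path"
  define C where "C n = (PiE {..n} (\<lambda>_. UNIV) :: 'd path set)" for n :: nat
  have cC: "countable (C n)" for n unfolding C_def by (intro countable_PiE) auto
  have pre_vimage: "pre n -` {y} = {X. \<forall>i\<le>n. X i = y i}" if "y \<in> C n" for n y
    using that by (auto simp: pre_def C_def restrict_def fun_eq_iff PiE_iff extensional_def)
  have pre_\<mu>: "pre n \<in> measurable \<mu> (count_space (C n))" for n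
  proof (subst measurable_count_space_eq_countable[OF cC], safe)
    fix y assume "y \<in> C n"
    have "{X \<in> space \<mu>. \<forall>i\<le>n. X i = y i} \<in> sets \<mu>" by measurable
    with pre_vimage[OF \<open>y \<in> C n\<close>] show "pre n -` {y} \<inter> space \<mu> \<in> sets \<mu>" by simp
  qed (simp add: pre_def C_def)
  have pre_\<nu>: "pre n \<in> measurable \<nu> (count_space (C n))" for n
    using pre_\<mu>[of n] by (simp cong: measurable_cong_sets add: sets_\<mu> sets_\<nu>)
  have D: "distr \<mu> (count_space (C n)) (pre n) = distr \<nu> (count_space (C n)) (pre n)" for n
  proof (rule measure_eqI_countable[OF _ _ cC])
    fix y assume y: "y \<in> C n"
    have "emeasure \<mu> {X. \<forall>i\<le>n. X i = y i} = emeasure \<nu> {X. \<forall>i\<le>n. X i = y i}"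
      by (simp add: M.emeasure_eq_measure N.emeasure_eq_measure eq)
    then show "emeasure (distr \<mu> (count_space (C n)) (pre n)) {y} =
        emeasure (distr \<nu> (count_space (C n)) (pre n)) {y}"
      using y by (simp add: emeasure_distr pre_\<mu> pre_\<nu> pre_vimage)
  qed auto
  show ?thesis
  proof (rule measure_eqI_PiM_infinite[OF sets_\<mu> sets_\<nu>])
    fix J :: "nat set" and A :: "nat \<Rightarrow> 'd site set"
    assume J: "finite J"
    define n where "n = Max (insert 0 J)"
    have le: "j \<le> n" if "j \<in> J" for j using that J by (simp add: n_def)
    define B where "B = {y \<in> C n. \<forall>j\<in>J. y j \<in> A j}"
    have E: "prod_emb UNIV (\<lambda>_. count_space UNIV) J (Pi\<^sub>E J A) = pre n -` B"
      using le by (auto simp: prod_emb_def space_PiM PiE_iff B_def C_def pre_def)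
    have "emeasure (distr \<mu> (count_space (C n)) (pre n)) B =
        emeasure (distr \<nu> (count_space (C n)) (pre n)) B" by (simp add: D)
    moreover have "B \<in> sets (count_space (C n))" by (auto simp: B_def)
    ultimately show "emeasure \<mu> (prod_emb UNIV (\<lambda>_. count_space UNIV) J (Pi\<^sub>E J A)) =
        emeasure \<nu> (prod_emb UNIV (\<lambda>_. count_space UNIV) J (Pi\<^sub>E J A))"
      unfolding E by (simp add: emeasure_distr pre_\<mu> pre_\<nu>)
  qed (use M.finite_measure_axioms in auto)
qed

theorem ex1_quenched_law:
  assumes "line_recurrent \<omega>" "\<omega> 0"
  shows "\<exists>!\<mu>. is_quenched_law \<omega> \<mu>"
proof (rule ex1I[of "is_quenched_law \<omega>" "walk_law \<omega>"])
  show "is_quenched_law \<omega> (walk_law \<omega>)" using assms by (rule is_quenched_law_walk_law)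
  fix \<mu> assume \<mu>: "is_quenched_law \<omega> \<mu>"
  show "\<mu> = walk_law \<omega>"
  proof (rule path_measure_eqI)
    show "measure \<mu> {X. \<forall>i\<le>n. X i = x i} = measure (walk_law \<omega>) {X. \<forall>i\<le>n. X i = x i}" for n x
      by (simp add: is_quenched_law_prefix[OF \<mu>] walk_law_prefix[OF assms(1)])
  qed (use \<mu> prob_space_walk_law in \<open>auto simp: is_quenched_law_def\<close>)
qed

lemma quenched_law_eq_walk_law:
  assumes "line_recurrent \<omega>" "\<omega> 0"
  shows "quenched_law \<omega> = walk_law \<omega>"
  unfolding quenched_law_def
  using ex1_quenched_law[OF assms] is_quenched_law_walk_law[OF assms] by (rule the1_equality)

lemma measurable_walk_law: "walk_law \<in> measurable config_space (prob_algebra path_space)"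
  unfolding walk_law_def
proof (rule measurable_distr_prob_space2[where M = path_space])
  show "(\<lambda>_. driving) \<in> measurable config_space (prob_algebra (path_space :: 'a path measure))"
    by (rule measurable_const)
      (simp add: space_prob_algebra prob_space_driving sets_driving)
qed (use measurable_walk_path in auto)

theorem emeasure_annealed_law:
  fixes Q :: "('d::finite) config measure"
  assumes "prob_space Q" "sets Q = sets config_space"
    and "measure Q origin_occupied > 0"
    and "AE \<omega> in conditioned Q. line_recurrent \<omega> \<and> \<omega> 0"
    and "G \<in> sets path_space"
  shows "emeasure (annealed_law Q) G = (\<integral>\<^sup>+\<omega>. emeasure (quenched_law \<omega>) G \<partial>conditioned Q)"
    and "prob_space (annealed_law Q)"
proof -
  interpret Q: prob_space Q by fact
  have O: "origin_occupied \<in> sets Q"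
  proof -
    have "{\<omega> \<in> space config_space. \<omega> 0} \<in> sets config_space" by measurable
    then show ?thesis by (simp add: assms(2) origin_occupied_def space_PiM)
  qed
  have pP: "prob_space (conditioned Q)"
    unfolding conditioned_def using assms(3)
    by (intro prob_space_uniform_measure) (auto simp: Q.emeasure_eq_measure)
  have sP: "sets (conditioned Q) = sets config_space" by (simp add: conditioned_def assms(2))
  have wl: "walk_law \<in> measurable (conditioned Q) (prob_algebra path_space)"
    using measurable_walk_law by (simp cong: measurable_cong_sets add: sP)
  let ?B = "conditioned Q \<bind> walk_law"
  have wl': "walk_law \<in> measurable (conditioned Q) (subprob_algebra path_space)"
    using wl by (rule measurable_prob_algebraD)
  have ne: "space (conditioned Q) \<noteq> {}" using pP by (rule prob_space.not_empty)
  have int: "(\<integral>\<^sup>+\<omega>. emeasure (quenched_law \<omega>) A \<partial>conditioned Q) = emeasure ?B A"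
    if "A \<in> sets path_space" for A
  proof -
    have "(\<integral>\<^sup>+\<omega>. emeasure (quenched_law \<omega>) A \<partial>conditioned Q) =
        (\<integral>\<^sup>+\<omega>. emeasure (walk_law \<omega>) A \<partial>conditioned Q)"
      using assms(4) by (intro nn_integral_cong_AE) (auto simp: quenched_law_eq_walk_law)
    then show ?thesis using emeasure_bind[OF ne wl' that] by simp
  qed
  have sB: "sets ?B = sets path_space" by (rule sets_bind[OF _ ne]) simp
  then have spB: "space ?B = UNIV" by (simp add: sets_eq_imp_space_eq[OF sB] space_PiM)
  have "annealed_law Q = measure_of UNIV (sets path_space) (emeasure ?B)"
    unfolding annealed_law_def
  proof (rule measure_of_eq)
    show "sets path_space \<subseteq> Pow UNIV" by simp
    show "(\<integral>\<^sup>+\<omega>. emeasure (quenched_law \<omega>) A \<partial>conditioned Q) = emeasure ?B A"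
      if "A \<in> sigma_sets UNIV (sets path_space)" for A
    proof (rule int)
      show "A \<in> sets path_space"
        using that sets.sigma_sets_eq[of "path_space :: 'd path measure"] by (simp add: space_PiM)
    qed
  qed
  also have "\<dots> = ?B" using measure_of_of_measure[of ?B] by (simp add: sB spB)
  finally have eq: "annealed_law Q = ?B" .
  show "emeasure (annealed_law Q) G = (\<integral>\<^sup>+\<omega>. emeasure (quenched_law \<omega>) G \<partial>conditioned Q)"
    using int[OF assms(5)] eq by simp
  show "prob_space (annealed_law Q)"
    unfolding eq using pP wl
    by (intro prob_space_bind'[OF _ wl]) (simp_all add: space_prob_algebra)
qed

end

theory Submission
  imports Defs
begin

text \<open>Almost surely every site sees occupied sites in all coordinate directions, and for such a
  configuration transience holds deterministically. The coordinate nearest neighbour relation is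
  then symmetric, so the walk is the simple random walk on a \<open>2d\<close>-regular graph. The
  Loomis--Whitney inequality applied to \<open>f\<^sup>4\<close> on a three-dimensional slice gives a
  Gagliardo--Nirenberg--Sobolev inequality: a finitely supported \<open>f \<ge> 0\<close> satisfies
  \<open>(f v)\<^sup>2 \<le> 16 E(f)\<close> with \<open>E(f)\<close> the sum of the squared increments of \<open>f\<close> over the edges.
  The truncated Green function \<open>g\<close> of the walk has \<open>E(g) \<le> 2d g(0)\<close>, so it is bounded
  uniformly in the truncation, and the Borel--Cantelli lemma applies.\<close>

section \<open>A discrete Sobolev inequality\<close>

lemma sum_sqrt_mult_le:
  fixes a b :: "'i \<Rightarrow> real"
  assumes "\<And>i. i \<in> I \<Longrightarrow> a i \<ge> 0" "\<And>i. i \<in> I \<Longrightarrow> b i \<ge> 0"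
  shows "(\<Sum>i\<in>I. sqrt (a i) * sqrt (b i)) \<le> sqrt (sum a I) * sqrt (sum b I)"
proof -
  have "(\<Sum>i\<in>I. sqrt (a i) * sqrt (b i))\<^sup>2 \<le> (\<Sum>i\<in>I. (sqrt (a i))\<^sup>2) * (\<Sum>i\<in>I. (sqrt (b i))\<^sup>2)"
    by (rule Cauchy_Schwarz_ineq_sum)
  also have "\<dots> = sum a I * sum b I"
    using assms by simp
  finally show ?thesis
    by (metis real_le_rsqrt real_sqrt_mult)
qed

text \<open>Two uses of Cauchy-Schwarz. For fixed \<open>x\<close> it is applied over the pairs
  \<open>(y, z)\<close>, where the sum of \<open>b x z * c x y\<close> factors; then over
  \<open>x\<close>, to the square roots of the two factors.\<close>

lemma loomis_whitney:
  fixes a :: "'y \<Rightarrow> 'z \<Rightarrow> real" and b :: "'x \<Rightarrow> 'z \<Rightarrow> real" and c :: "'x \<Rightarrow> 'y \<Rightarrow> real"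
  assumes a: "\<And>y z. a y z \<ge> 0" and b: "\<And>x z. b x z \<ge> 0" and c: "\<And>x y. c x y \<ge> 0"
  shows "(\<Sum>x\<in>X. \<Sum>y\<in>Y. \<Sum>z\<in>Z. sqrt (a y z * b x z * c x y)) \<le>
    sqrt ((\<Sum>y\<in>Y. \<Sum>z\<in>Z. a y z) * (\<Sum>x\<in>X. \<Sum>z\<in>Z. b x z) * (\<Sum>x\<in>X. \<Sum>y\<in>Y. c x y))"
proof -
  let ?A = "\<Sum>y\<in>Y. \<Sum>z\<in>Z. a y z" and ?B = "\<lambda>x. \<Sum>z\<in>Z. b x z" and ?C = "\<lambda>x. \<Sum>y\<in>Y. c x y"
  have "(\<Sum>y\<in>Y. \<Sum>z\<in>Z. sqrt (a y z * b x z * c x y)) \<le> sqrt ?A * (sqrt (?B x) * sqrt (?C x))" for x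
  proof -
    have "(\<Sum>y\<in>Y. \<Sum>z\<in>Z. sqrt (a y z * b x z * c x y)) =
        (\<Sum>(y, z)\<in>Y \<times> Z. sqrt (a y z) * sqrt (b x z * c x y))"
      by (simp add: sum.cartesian_product real_sqrt_mult mult.assoc)
    also have "\<dots> \<le> sqrt (\<Sum>(y, z)\<in>Y \<times> Z. a y z) * sqrt (\<Sum>(y, z)\<in>Y \<times> Z. b x z * c x y)"
      using sum_sqrt_mult_le[of "Y \<times> Z" "\<lambda>(y, z). a y z" "\<lambda>(y, z). b x z * c x y"] a b c
      by (simp add: case_prod_beta)
    also have "(\<Sum>(y, z)\<in>Y \<times> Z. b x z * c x y) = ?B x * ?C x"
      by (simp add: sum.cartesian_product[symmetric] sum_distrib_right[symmetric]
          sum_distrib_left[symmetric])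
    finally show ?thesis
      by (simp add: sum.cartesian_product real_sqrt_mult)
  qed
  then have "(\<Sum>x\<in>X. \<Sum>y\<in>Y. \<Sum>z\<in>Z. sqrt (a y z * b x z * c x y)) \<le>
      (\<Sum>x\<in>X. sqrt ?A * (sqrt (?B x) * sqrt (?C x)))"
    by (rule sum_mono)
  also have "\<dots> = sqrt ?A * (\<Sum>x\<in>X. sqrt (?B x) * sqrt (?C x))"
    by (simp add: sum_distrib_left)
  also have "\<dots> \<le> sqrt ?A * (sqrt (sum ?B X) * sqrt (sum ?C X))"
    using a b c by (intro mult_left_mono sum_sqrt_mult_le) (auto intro!: sum_nonneg)
  finally show ?thesis
    by (simp add: real_sqrt_mult mult.assoc)
qed

lemma sum_fibres:
  fixes D :: "'a \<Rightarrow> real"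
  assumes "finite S"
  shows "(\<Sum>u\<in>q ` S. \<Sum>v\<in>r ` S. sum D {y\<in>S. (q y, r y) = (u, v)}) = sum D S"
proof -
  have "(\<Sum>u\<in>q ` S. \<Sum>v\<in>r ` S. sum D {y\<in>S. (q y, r y) = (u, v)}) =
      (\<Sum>w\<in>q ` S \<times> r ` S. sum D {y\<in>S. (q y, r y) = w})"
    unfolding sum.cartesian_product by (intro sum.cong) auto
  also have "\<dots> = sum D S"
    using assms by (intro sum.group) auto
  finally show ?thesis .
qed

text \<open>Loomis-Whitney for a finite set separated by three coordinates. A sum of
  \<open>D1\<close> over a line in direction \<open>p\<close> depends on \<open>q\<close> and
  \<open>r\<close> alone, and likewise for \<open>D2\<close> and \<open>D3\<close>; the product of
  the three line bounds dominates \<open>h ^ 3\<close>.\<close>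

lemma loomis_whitney_fibres:
  fixes D1 D2 D3 h :: "'a \<Rightarrow> real" and p q r :: "'a \<Rightarrow> 'b"
  assumes fin: "finite S" and inj: "inj_on (\<lambda>x. (p x, q x, r x)) S"
    and D: "\<And>x. D1 x \<ge> 0" "\<And>x. D2 x \<ge> 0" "\<And>x. D3 x \<ge> 0"
    and h0: "\<And>x. h x \<ge> 0"
    and h: "\<And>x. x \<in> S \<Longrightarrow> h x \<le> sum D1 {y\<in>S. (q y, r y) = (q x, r x)}"
      "\<And>x. x \<in> S \<Longrightarrow> h x \<le> sum D2 {y\<in>S. (p y, r y) = (p x, r x)}"
      "\<And>x. x \<in> S \<Longrightarrow> h x \<le> sum D3 {y\<in>S. (p y, q y) = (p x, q x)}"
  shows "(\<Sum>x\<in>S. sqrt (h x ^ 3)) \<le> sqrt (sum D1 S * sum D2 S * sum D3 S)"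
proof -
  define a where "a u v = sum D1 {y\<in>S. (q y, r y) = (u, v)}" for u v
  define b where "b u v = sum D2 {y\<in>S. (p y, r y) = (u, v)}" for u v
  define c where "c u v = sum D3 {y\<in>S. (p y, q y) = (u, v)}" for u v
  have nn: "a u v \<ge> 0" "b u v \<ge> 0" "c u v \<ge> 0" for u v
    using D by (auto simp: a_def b_def c_def intro!: sum_nonneg)
  define G where "G = (\<lambda>(u, v, w). sqrt (a v w * b u w * c u v))"
  have "(\<Sum>x\<in>S. sqrt (h x ^ 3)) \<le> (\<Sum>x\<in>S. G (p x, q x, r x))"
  proof (rule sum_mono)
    fix x assume x: "x \<in> S"
    have "h x * h x * h x \<le> a (q x) (r x) * b (p x) (r x) * c (p x) (q x)"
      using h[OF x] h0 nn by (intro mult_mono) (auto simp: a_def b_def c_def)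
    then show "sqrt (h x ^ 3) \<le> G (p x, q x, r x)"
      by (simp add: G_def power3_eq_cube)
  qed
  also have "\<dots> = sum G ((\<lambda>x. (p x, q x, r x)) ` S)"
    using inj by (simp add: sum.reindex)
  \<comment> \<open>The box of coordinate triples may exceed the image of \<open>S\<close>, but
    \<open>G\<close> is nonnegative.\<close>
  also have "\<dots> \<le> sum G (p ` S \<times> q ` S \<times> r ` S)"
    using fin nn by (intro sum_mono2) (auto simp: G_def)
  also have "\<dots> = (\<Sum>u\<in>p ` S. \<Sum>v\<in>q ` S. \<Sum>w\<in>r ` S. sqrt (a v w * b u w * c u v))"
    by (simp add: G_def sum.cartesian_product)
  also have "\<dots> \<le> sqrt ((\<Sum>v\<in>q ` S. \<Sum>w\<in>r ` S. a v w) * (\<Sum>u\<in>p ` S. \<Sum>w\<in>r ` S. b u w) *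
      (\<Sum>u\<in>p ` S. \<Sum>v\<in>q ` S. c u v))"
    using nn by (rule loomis_whitney)
  also have "(\<Sum>v\<in>q ` S. \<Sum>w\<in>r ` S. a v w) = sum D1 S"
    unfolding a_def by (rule sum_fibres[OF fin])
  also have "(\<Sum>u\<in>p ` S. \<Sum>w\<in>r ` S. b u w) = sum D2 S"
    unfolding b_def by (rule sum_fibres[OF fin])
  also have "(\<Sum>u\<in>p ` S. \<Sum>v\<in>q ` S. c u v) = sum D3 S"
    unfolding c_def by (rule sum_fibres[OF fin])
  finally show ?thesis .
qed

section \<open>Increments along lines and the pointwise bound\<close>

text \<open>Telescoping along \<open>x\<close>, \<open>s x\<close>, \<open>s (s x)\<close>, ...: as
  \<open>p\<close> strictly increases and \<open>S\<close> is finite, the orbit leaves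
  \<open>S\<close>, and there \<open>h\<close> vanishes. The induction is on the number of points of
  \<open>S\<close> on the line that are not behind \<open>x\<close>.\<close>

lemma le_sum_along_line:
  fixes h :: "'a \<Rightarrow> real" and p :: "'a \<Rightarrow> int"
  assumes fin: "finite S" and s: "\<And>x. x \<in> S \<Longrightarrow> s x \<in> S \<or> h (s x) = 0"
    and \<pi>: "\<And>x. x \<in> S \<Longrightarrow> \<pi> (s x) = \<pi> x" and p: "\<And>x. x \<in> S \<Longrightarrow> p x < p (s x)"
    and x: "x \<in> S"
  shows "h x \<le> (\<Sum>y\<in>{y\<in>S. \<pi> y = \<pi> x}. \<bar>h y - h (s y)\<bar>)"
proof -
  define R where "R x = {y\<in>S. \<pi> y = \<pi> x \<and> p x \<le> p y}" for x
  have finR: "finite (R x)" for x using fin by (simp add: R_def)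
  have "h x \<le> (\<Sum>y\<in>R x. \<bar>h y - h (s y)\<bar>)"
    using x
  proof (induction "card (R x)" arbitrary: x rule: less_induct)
    case less
    have xR: "x \<in> R x" "x \<notin> R (s x)" using p[OF less.prems] less.prems by (auto simp: R_def)
    have sub: "insert x (R (s x)) \<subseteq> R x" using \<pi>[OF less.prems] p[OF less.prems] less.prems by (auto simp: R_def)
    then have "card (R (s x)) < card (R x)"
      using xR finR by (intro psubset_card_mono) auto
    then have "h (s x) \<le> (\<Sum>y\<in>R (s x). \<bar>h y - h (s y)\<bar>)"
      using s[OF less.prems] less.hyps[of "s x"] by (auto intro: sum_nonneg)
    then have "h x \<le> (\<Sum>y\<in>insert x (R (s x)). \<bar>h y - h (s y)\<bar>)"
      using xR finR by simp
    also have "\<dots> \<le> (\<Sum>y\<in>R x. \<bar>h y - h (s y)\<bar>)"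
      using sub finR by (intro sum_mono2) auto
    finally show ?case .
  qed
  also have "\<dots> \<le> (\<Sum>y\<in>{y\<in>S. \<pi> y = \<pi> x}. \<bar>h y - h (s y)\<bar>)"
    using fin by (intro sum_mono2) (auto simp: R_def)
  finally show ?thesis .
qed

lemma sum_comp_le:
  fixes f :: "'a \<Rightarrow> real"
  assumes "finite S" "inj_on s S" "\<And>x. x \<in> S \<Longrightarrow> s x \<in> S \<or> f (s x) = 0" "\<And>x. f x \<ge> 0"
  shows "(\<Sum>x\<in>S. f (s x)) \<le> sum f S"
proof -
  have "(\<Sum>x\<in>S. f (s x)) = (\<Sum>x\<in>{x\<in>S. s x \<in> S}. f (s x))"
    using assms by (intro sum.mono_neutral_right) auto
  also have "\<dots> = sum f (s ` {x\<in>S. s x \<in> S})"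
    using assms(2) by (subst sum.reindex) (auto intro: inj_on_subset)
  also have "\<dots> \<le> sum f S"
    using assms by (intro sum_mono2) auto
  finally show ?thesis .
qed

text \<open>A difference of fourth powers splits into \<open>a - b\<close> times a term of cubic
  size, and Cauchy-Schwarz separates the two. The constant is the 8 of \<open>**\<close>, doubled
  when \<open>sum_comp_le\<close> absorbs the values at \<open>s x\<close>.\<close>

lemma sum_diff_power4_le:
  fixes f :: "'a \<Rightarrow> real"
  assumes fin: "finite S" and inj: "inj_on s S"
    and s: "\<And>x. x \<in> S \<Longrightarrow> s x \<in> S \<or> f (s x) = 0" and f: "\<And>x. f x \<ge> 0"
  shows "(\<Sum>x\<in>S. \<bar>f x ^ 4 - f (s x) ^ 4\<bar>)\<^sup>2 \<le>
    16 * (\<Sum>x\<in>S. (f x - f (s x))\<^sup>2) * (\<Sum>x\<in>S. f x ^ 6)"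
proof -
  have *: "\<bar>a ^ 4 - b ^ 4\<bar> \<le> \<bar>a - b\<bar> * (2 * (a ^ 3 + b ^ 3))" if "a \<ge> 0" "b \<ge> 0" for a b :: real
  proof -
    have "a ^ 4 - b ^ 4 = (a - b) * ((a + b) * (a\<^sup>2 + b\<^sup>2))"
      by (simp add: algebra_simps power2_eq_square power4_eq_xxxx)
    moreover have "(a + b) * (a\<^sup>2 + b\<^sup>2) \<le> 2 * (a ^ 3 + b ^ 3)"
    proof -
      have "2 * (a ^ 3 + b ^ 3) - (a + b) * (a\<^sup>2 + b\<^sup>2) = (a + b) * (a - b)\<^sup>2"
        by (simp add: algebra_simps power2_eq_square power3_eq_cube)
      then show ?thesis using that by (smt (verit) mult_nonneg_nonneg zero_le_power2)
    qed
    moreover have "(a + b) * (a\<^sup>2 + b\<^sup>2) \<ge> 0" using that by simp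
    ultimately show ?thesis
      by (simp add: abs_mult mult_left_mono)
  qed
  have **: "(2 * (a ^ 3 + b ^ 3))\<^sup>2 \<le> 8 * (a ^ 6 + b ^ 6)" for a b :: real
  proof -
    have "8 * (a ^ 6 + b ^ 6) - (2 * (a ^ 3 + b ^ 3))\<^sup>2 = (2 * (a ^ 3 - b ^ 3))\<^sup>2"
      by (simp add: algebra_simps power2_eq_square numeral_eq_Suc)
    then show ?thesis by (smt (verit) zero_le_power2)
  qed
  have "(\<Sum>x\<in>S. \<bar>f x ^ 4 - f (s x) ^ 4\<bar>)\<^sup>2 \<le>
      (\<Sum>x\<in>S. \<bar>f x - f (s x)\<bar> * (2 * (f x ^ 3 + f (s x) ^ 3)))\<^sup>2"
    using f * by (intro power_mono sum_mono sum_nonneg) auto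
  also have "\<dots> \<le> (\<Sum>x\<in>S. \<bar>f x - f (s x)\<bar>\<^sup>2) * (\<Sum>x\<in>S. (2 * (f x ^ 3 + f (s x) ^ 3))\<^sup>2)"
    by (rule Cauchy_Schwarz_ineq_sum)
  also have "\<dots> \<le> (\<Sum>x\<in>S. (f x - f (s x))\<^sup>2) * (\<Sum>x\<in>S. 8 * (f x ^ 6 + f (s x) ^ 6))"
    using ** by (simp add: mult_left_mono sum_mono sum_nonneg)
  also have "\<dots> \<le> (\<Sum>x\<in>S. (f x - f (s x))\<^sup>2) * (16 * (\<Sum>x\<in>S. f x ^ 6))"
  proof (intro mult_left_mono sum_nonneg)
    show "(\<Sum>x\<in>S. 8 * (f x ^ 6 + f (s x) ^ 6)) \<le> 16 * (\<Sum>x\<in>S. f x ^ 6)"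
      using sum_comp_le[of S s "\<lambda>x. f x ^ 6"] fin inj s f
      by (auto simp: sum_distrib_left[symmetric] sum.distrib)
  qed simp
  finally show ?thesis
    by (simp add: mult_ac)
qed

text \<open>The sum \<open>T\<close> of sixth powers bounds itself:
  \<open>T ^ 2 \<le> B s1 * B s2 * B s3\<close> and each \<open>(B s) ^ 2\<close> is at most
  \<open>16 * E * T\<close>, so \<open>T ^ 4 \<le> (16 * E) ^ 3 * T ^ 3\<close>. Cancelling leaves a
  bound by \<open>E\<close> alone, and \<open>f v ^ 6\<close> is one term of
  \<open>T\<close>.\<close>

lemma sobolev_pointwise:
  fixes f :: "'a \<Rightarrow> real" and p q r :: "'a \<Rightarrow> int"
  assumes fin: "finite S" and inj: "inj_on (\<lambda>x. (p x, q x, r x)) S" and f: "\<And>x. f x \<ge> 0"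
    and inj_s: "inj_on s1 S" "inj_on s2 S" "inj_on s3 S"
    and s: "\<And>x. x \<in> S \<Longrightarrow> s1 x \<in> S \<or> f (s1 x) = 0" "\<And>x. x \<in> S \<Longrightarrow> s2 x \<in> S \<or> f (s2 x) = 0"
      "\<And>x. x \<in> S \<Longrightarrow> s3 x \<in> S \<or> f (s3 x) = 0"
    and s1: "\<And>x. x \<in> S \<Longrightarrow> p x < p (s1 x) \<and> q (s1 x) = q x \<and> r (s1 x) = r x"
    and s2: "\<And>x. x \<in> S \<Longrightarrow> q x < q (s2 x) \<and> p (s2 x) = p x \<and> r (s2 x) = r x"
    and s3: "\<And>x. x \<in> S \<Longrightarrow> r x < r (s3 x) \<and> p (s3 x) = p x \<and> q (s3 x) = q x"
    and E: "(\<Sum>x\<in>S. (f x - f (s1 x))\<^sup>2) \<le> E" "(\<Sum>x\<in>S. (f x - f (s2 x))\<^sup>2) \<le> E"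
      "(\<Sum>x\<in>S. (f x - f (s3 x))\<^sup>2) \<le> E"
    and v: "v \<in> S"
  shows "(f v)\<^sup>2 \<le> 16 * E"
proof -
  define T where "T = (\<Sum>x\<in>S. f x ^ 6)"
  define B where "B s = (\<Sum>x\<in>S. \<bar>f x ^ 4 - f (s x) ^ 4\<bar>)" for s
  have T0: "T \<ge> 0" using f by (auto simp: T_def intro: sum_nonneg)
  have B0: "B s \<ge> 0" for s by (auto simp: B_def intro: sum_nonneg)
  have B: "(B s1)\<^sup>2 \<le> 16 * E * T" "(B s2)\<^sup>2 \<le> 16 * E * T" "(B s3)\<^sup>2 \<le> 16 * E * T"
  proof -
    have *: "(B s)\<^sup>2 \<le> 16 * E * T"
      if "inj_on s S" "\<And>x. x \<in> S \<Longrightarrow> s x \<in> S \<or> f (s x) = 0"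
        "(\<Sum>x\<in>S. (f x - f (s x))\<^sup>2) \<le> E" for s
    proof -
      have "(B s)\<^sup>2 \<le> 16 * (\<Sum>x\<in>S. (f x - f (s x))\<^sup>2) * T"
        unfolding B_def T_def using fin that f by (intro sum_diff_power4_le) auto
      also have "\<dots> \<le> 16 * E * T" using that T0 by (intro mult_right_mono) auto
      finally show ?thesis .
    qed
    show "(B s1)\<^sup>2 \<le> 16 * E * T" "(B s2)\<^sup>2 \<le> 16 * E * T" "(B s3)\<^sup>2 \<le> 16 * E * T"
      by (intro *; use inj_s s E in blast)+
  qed
  have E0: "E \<ge> 0" using E(1) by (meson order_trans sum_nonneg zero_le_power2)
  \<comment> \<open>The exponent 4 is chosen so that the power 3/2 of Loomis-Whitney yields
    \<open>f x ^ 6\<close>, the same power that Cauchy-Schwarz leaves in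
    \<open>sum_diff_power4_le\<close>.\<close>
  have "(\<Sum>x\<in>S. sqrt ((f x ^ 4) ^ 3)) \<le> sqrt (B s1 * B s2 * B s3)"
    unfolding B_def
  proof (rule loomis_whitney_fibres[OF fin inj])
    fix x assume x: "x \<in> S"
    show "f x ^ 4 \<le> (\<Sum>y\<in>{y\<in>S. (q y, r y) = (q x, r x)}. \<bar>f y ^ 4 - f (s1 y) ^ 4\<bar>)"
      by (rule le_sum_along_line[OF fin _ _ _ x, where p = p]) (use s(1) s1 in auto)
    show "f x ^ 4 \<le> (\<Sum>y\<in>{y\<in>S. (p y, r y) = (p x, r x)}. \<bar>f y ^ 4 - f (s2 y) ^ 4\<bar>)"
      by (rule le_sum_along_line[OF fin _ _ _ x, where p = q]) (use s(2) s2 in auto)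
    show "f x ^ 4 \<le> (\<Sum>y\<in>{y\<in>S. (p y, q y) = (p x, q x)}. \<bar>f y ^ 4 - f (s3 y) ^ 4\<bar>)"
      by (rule le_sum_along_line[OF fin _ _ _ x, where p = r]) (use s(3) s3 in auto)
  qed auto
  moreover have "sqrt ((f x ^ 4) ^ 3) = f x ^ 6" for x
  proof -
    have "(f x ^ 4) ^ 3 = (f x ^ 6)\<^sup>2" by (simp flip: power_mult)
    then show ?thesis using f[of x] by (simp only: real_sqrt_abs) simp
  qed
  ultimately have "T \<le> sqrt (B s1 * B s2 * B s3)" by (simp add: T_def)
  then have "T\<^sup>2 \<le> B s1 * B s2 * B s3"
    using T0 B0 by (metis mult_nonneg_nonneg power_mono real_sqrt_pow2)
  then have "(T\<^sup>2)\<^sup>2 \<le> (B s1 * B s2 * B s3)\<^sup>2" by (rule power_mono) simp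
  also have "\<dots> = (B s1)\<^sup>2 * (B s2)\<^sup>2 * (B s3)\<^sup>2" by (simp add: power_mult_distrib)
  also have "\<dots> \<le> (16 * E * T) * (16 * E * T) * (16 * E * T)"
    using B E0 T0 by (intro mult_mono) auto
  finally have TT: "T * T ^ 3 \<le> (16 * E) ^ 3 * T ^ 3"
    by (simp add: power2_eq_square power3_eq_cube mult_ac)
  have "T \<le> (16 * E) ^ 3"
  proof (cases "T = 0")
    case True
    then show ?thesis using E0 by simp
  next
    case False
    then have "T ^ 3 > 0" using T0 by simp
    with TT show ?thesis by (rule mult_right_le_imp_le)
  qed
  moreover have "f v ^ 6 \<le> T"
    unfolding T_def using fin v f by (intro member_le_sum) auto
  ultimately have "((f v)\<^sup>2) ^ 3 \<le> (16 * E) ^ 3" by (simp flip: power_mult)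
  then show ?thesis
    using E0 power_mono_iff[of "(f v)\<^sup>2" "16 * E" 3] by simp
qed

section \<open>The graph of coordinate nearest neighbours\<close>

lemma uminus_dirs: "e \<in> dirs \<Longrightarrow> - e \<in> dirs"
  by (auto simp: dirs_def)

lemma unit_vec_dirs [simp]: "unit_vec i \<in> dirs"
  by (simp add: dirs_def)

lemma sum_dirs: "(\<Sum>e\<in>dirs. g e) = (\<Sum>i\<in>UNIV. g (unit_vec i) + g (- unit_vec i :: ('d::finite) site))"
  for g :: "_ \<Rightarrow> real"
proof -
  have "range unit_vec \<inter> uminus ` range unit_vec = ({} :: 'd site set)"
    using axis_neq_uminus_axis by (auto simp: unit_vec_def)
  then have "(\<Sum>e\<in>dirs. g e) = sum g (range unit_vec) + sum g (uminus ` range unit_vec)"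
    unfolding dirs_def by (intro sum.union_disjoint) auto
  also have "sum g (range unit_vec) = (\<Sum>i\<in>UNIV. g (unit_vec i))"
    by (simp add: sum.reindex inj_unit_vec)
  also have "sum g (uminus ` range unit_vec) = (\<Sum>i\<in>UNIV. g (- unit_vec i))"
    by (simp add: sum.reindex inj_unit_vec)
  finally show ?thesis by (simp add: sum.distrib)
qed

text \<open>No occupied site lies strictly between \<open>v\<close> and its neighbour in direction
  \<open>e\<close>, so the search back from the neighbour stops at \<open>v\<close>, which is
  occupied. This is the symmetry of the graph.\<close>

lemma step_reverse:
  assumes "line_recurrent \<omega>" "v \<in> points \<omega>" "e \<in> dirs"
  shows "step \<omega> (step \<omega> v e) (- e) = v"
proof -
  define k where "k = first_dist (shift v \<omega>) e"
  have k: "k > 0" "\<omega> (v + int k *s e)"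
    using first_dist_pos[OF assms(1,3)] by (auto simp: k_def)
  have min: "\<not> \<omega> (v + int l *s e)" if "0 < l" "l < k" for l
    using that not_less_Least[of l "\<lambda>k. k > 0 \<and> shift v \<omega> (int k *s e)"]
    by (auto simp: k_def first_dist_def shift_def)
  have eq: "v + int k *s e + int l *s (- e) = v + (int k - int l) *s e" for l
    by (simp add: vec_eq_iff algebra_simps)
  have "first_dist (shift (v + int k *s e) \<omega>) (- e) = k"
    unfolding first_dist_def
  proof (rule Least_equality)
    show "0 < k \<and> shift (v + int k *s e) \<omega> (int k *s - e)"
      using k assms(2) unfolding shift_def eq by (simp add: points_def)
    fix l assume "0 < l \<and> shift (v + int k *s e) \<omega> (int l *s - e)"
    then have "0 < l" "\<omega> (v + (int k - int l) *s e)" unfolding shift_def eq by auto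
    \<comment> \<open>For \<open>l < k\<close> the site found lies at distance \<open>k - l\<close>
      ahead of \<open>v\<close>, strictly before its neighbour, which \<open>min\<close>
      excludes.\<close>
    then show "k \<le> l"
      using min[of "k - l"] by (cases "k \<le> l") auto
  qed
  then show ?thesis
    using eq[of k] by (simp add: step_def k_def[symmetric])
qed

lemma inj_on_step_points:
  assumes "line_recurrent \<omega>" "e \<in> dirs"
  shows "inj_on (\<lambda>x. step \<omega> x e) (points \<omega>)"
  by (rule inj_on_inverseI[where g = "\<lambda>x. step \<omega> x (- e)"])
    (rule step_reverse[OF assms(1) _ assms(2)])

lemma step_unit_vec_nth:
  assumes "line_recurrent \<omega>"
  shows "x $ i < step \<omega> x (unit_vec i) $ i"
    and "l \<noteq> i \<Longrightarrow> step \<omega> x (unit_vec i) $ l = x $ l"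
  using first_dist_pos[OF assms unit_vec_dirs, of x i]
  by (auto simp: step_def unit_vec_def axis_def)

text \<open>Only three of the coordinates are used: the steps in these directions stay in the
  three-dimensional slice through \<^term>\<open>v\<close>, and the remaining edges only increase the energy.\<close>

lemma point_evaluation_le_energy:
  fixes \<omega> :: "('d::finite) config" and f :: "'d site \<Rightarrow> real"
  assumes d: "CARD('d) \<ge> 3" and rec: "line_recurrent \<omega>"
    and fin: "finite {x. f x \<noteq> 0}" and supp: "{x. f x \<noteq> 0} \<subseteq> points \<omega>" and f: "\<And>x. f x \<ge> 0"
  shows "(f v)\<^sup>2 \<le> 16 * (\<Sum>i\<in>UNIV. \<Sum>x\<in>{x. f x \<noteq> 0}. (f x - f (step \<omega> x (unit_vec i)))\<^sup>2)"
proof (cases "f v = 0")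
  case True
  then show ?thesis by (auto intro!: sum_nonneg)
next
  case False
  obtain T :: "'d set" where "card T = 3"
    using obtain_subset_with_card_n[OF d] by metis
  then obtain i j k :: 'd where ijk: "i \<noteq> j" "j \<noteq> k" "i \<noteq> k"
    by (auto simp: card_3_iff)
  let ?F = "{x. f x \<noteq> 0}"
  define S where "S = {x\<in>?F. \<forall>l. l \<notin> {i, j, k} \<longrightarrow> x $ l = v $ l}"
  define s where "s l x = step \<omega> x (unit_vec l)" for l x
  have finS: "finite S" using fin by (simp add: S_def)
  have inj_s: "inj_on (s l) S" for l
    unfolding s_def using supp
    by (intro inj_on_subset[OF inj_on_step_points[OF rec unit_vec_dirs]]) (auto simp: S_def)
  have nth: "x $ l < s l x $ l" "m \<noteq> l \<Longrightarrow> s l x $ m = x $ m" for l m x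
    using step_unit_vec_nth[OF rec] by (auto simp: s_def)
  \<comment> \<open>A step in one of the three directions stays in the slice, so it can leave
    \<open>S\<close> only by leaving the support of \<open>f\<close>.\<close>
  have S: "s l x \<in> S \<or> f (s l x) = 0" if "x \<in> S" "l \<in> {i, j, k}" for l x
    using that nth(2) by (auto simp: S_def)
  have E: "(\<Sum>x\<in>S. (f x - f (s l x))\<^sup>2) \<le> (\<Sum>i\<in>UNIV. \<Sum>x\<in>?F. (f x - f (s i x))\<^sup>2)" for l
  proof -
    have "(\<Sum>x\<in>S. (f x - f (s l x))\<^sup>2) \<le> (\<Sum>x\<in>?F. (f x - f (s l x))\<^sup>2)"
      using fin by (intro sum_mono2) (auto simp: S_def)
    also have "\<dots> \<le> (\<Sum>i\<in>UNIV. \<Sum>x\<in>?F. (f x - f (s i x))\<^sup>2)"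
      by (rule member_le_sum[where f = "\<lambda>i. \<Sum>x\<in>?F. (f x - f (s i x))\<^sup>2"]) (auto intro: sum_nonneg)
    finally show ?thesis .
  qed
  have "inj_on (\<lambda>x. (x $ i, x $ j, x $ k)) S"
  proof (rule inj_onI)
    fix x y assume xy: "x \<in> S" "y \<in> S" "(x $ i, x $ j, x $ k) = (y $ i, y $ j, y $ k)"
    have "x $ l = y $ l" for l
      using xy by (cases "l \<in> {i, j, k}") (auto simp: S_def)
    then show "x = y" by (simp add: vec_eq_iff)
  qed
  then have "(f v)\<^sup>2 \<le> 16 * (\<Sum>i\<in>UNIV. \<Sum>x\<in>?F. (f x - f (s i x))\<^sup>2)"
    by (rule sobolev_pointwise[OF finS _ f inj_s[of i] inj_s[of j] inj_s[of k] _ _ _ _ _ _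
          E[of i] E[of j] E[of k]])
      (use S nth ijk False in \<open>auto simp: S_def\<close>)
  then show ?thesis by (simp add: s_def)
qed

text \<open>Summation by parts, axis by axis. It is an inequality because the left side starts its
  edges in the support and so misses those that enter the support from a zero of \<open>f\<close> in
  a positive direction.\<close>

lemma energy_le_laplacian:
  fixes \<omega> :: "('d::finite) config" and f :: "'d site \<Rightarrow> real"
  assumes rec: "line_recurrent \<omega>"
    and fin: "finite {x. f x \<noteq> 0}" and supp: "{x. f x \<noteq> 0} \<subseteq> points \<omega>" and f: "\<And>x. f x \<ge> 0"
  shows "(\<Sum>i\<in>UNIV. \<Sum>x\<in>{x. f x \<noteq> 0}. (f x - f (step \<omega> x (unit_vec i)))\<^sup>2) \<le>
    (\<Sum>x\<in>{x. f x \<noteq> 0}. f x * (\<Sum>e\<in>dirs. f x - f (step \<omega> x e)))"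
proof -
  let ?F = "{x. f x \<noteq> 0}"
  have *: "(\<Sum>x\<in>?F. (f x - f (step \<omega> x e))\<^sup>2) \<le>
      (\<Sum>x\<in>?F. f x * ((f x - f (step \<omega> x e)) + (f x - f (step \<omega> x (- e)))))"
    if e: "e = unit_vec i" for e i
  proof -
    have ed: "e \<in> dirs" "- e \<in> dirs" using e by (auto intro: uminus_dirs)
    have rev: "step \<omega> (step \<omega> x e) (- e) = x" "step \<omega> (step \<omega> x (- e)) e = x" if "x \<in> ?F" for x
      using step_reverse[OF rec _ ed(1)] step_reverse[OF rec _ ed(2)] supp that by auto
    have "(\<Sum>x\<in>?F. (f (step \<omega> x e))\<^sup>2) \<le> (\<Sum>x\<in>?F. (f x)\<^sup>2)"
      using fin inj_on_step_points[OF rec ed(1)] supp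
      by (intro sum_comp_le[of ?F "\<lambda>x. step \<omega> x e" "\<lambda>x. (f x)\<^sup>2"]) (auto intro: inj_on_subset)
    \<comment> \<open>Reversal matches the edges traversed along \<open>- e\<close> with those
      traversed along \<open>e\<close>, so both cross terms agree.\<close>
    moreover have "(\<Sum>x\<in>?F. f x * f (step \<omega> x (- e))) = (\<Sum>x\<in>?F. f x * f (step \<omega> x e))"
    proof -
      have "(\<Sum>x\<in>?F. f x * f (step \<omega> x (- e))) =
          (\<Sum>x\<in>{x\<in>?F. step \<omega> x (- e) \<in> ?F}. f x * f (step \<omega> x (- e)))"
        using fin by (intro sum.mono_neutral_right) auto
      also have "\<dots> = (\<Sum>x\<in>{x\<in>?F. step \<omega> x e \<in> ?F}. f x * f (step \<omega> x e))"
        using rev by (intro sum.reindex_bij_witness[of _ "\<lambda>x. step \<omega> x e" "\<lambda>x. step \<omega> x (- e)"]) auto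
      also have "\<dots> = (\<Sum>x\<in>?F. f x * f (step \<omega> x e))"
        using fin by (intro sum.mono_neutral_left) auto
      finally show ?thesis .
    qed
    moreover have "(\<Sum>x\<in>?F. (f x - f (step \<omega> x e))\<^sup>2) =
        (\<Sum>x\<in>?F. (f x)\<^sup>2) + (\<Sum>x\<in>?F. (f (step \<omega> x e))\<^sup>2) - 2 * (\<Sum>x\<in>?F. f x * f (step \<omega> x e))"
      by (simp add: power2_diff sum.distrib sum_subtractf sum_distrib_left mult.assoc)
    moreover have "(\<Sum>x\<in>?F. f x * ((f x - f (step \<omega> x e)) + (f x - f (step \<omega> x (- e))))) =
        2 * (\<Sum>x\<in>?F. (f x)\<^sup>2) - (\<Sum>x\<in>?F. f x * f (step \<omega> x e)) - (\<Sum>x\<in>?F. f x * f (step \<omega> x (- e)))"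
      by (simp add: algebra_simps sum.distrib sum_subtractf sum_distrib_left power2_eq_square)
    ultimately show ?thesis by linarith
  qed
  have "(\<Sum>i\<in>UNIV. \<Sum>x\<in>?F. (f x - f (step \<omega> x (unit_vec i)))\<^sup>2) \<le>
      (\<Sum>i\<in>UNIV. \<Sum>x\<in>?F. f x * ((f x - f (step \<omega> x (unit_vec i))) + (f x - f (step \<omega> x (- unit_vec i)))))"
    by (rule sum_mono) (rule *[OF refl])
  also have "\<dots> = (\<Sum>x\<in>?F. f x * (\<Sum>e\<in>dirs. f x - f (step \<omega> x e)))"
    by (subst sum.swap) (simp add: sum_dirs sum_distrib_left)
  finally show ?thesis .
qed

section \<open>The quenched walk\<close>

lemma walk_cong: "(\<And>i. i < n \<Longrightarrow> \<xi> i = \<xi>' i) \<Longrightarrow> walk \<omega> \<xi> n = walk \<omega> \<xi>' n"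
  by (induction n) auto

lemma walk_in_points:
  assumes "line_recurrent \<omega>" "\<omega> 0" "\<And>n. \<xi> n \<in> dirs"
  shows "walk \<omega> \<xi> n \<in> points \<omega>"
  using assms step_in_points by (cases n) (auto simp: points_def)

lemma sets_driving_Collect:
  "{\<xi> \<in> space path_space. P \<xi>} \<in> sets path_space \<Longrightarrow> {\<xi>. P \<xi>} \<in> sets driving"
  by (simp add: sets_driving space_PiM)

text \<open>Independence of the next direction from the past, by counting: up to a null set the
  event is a disjoint union of cylinders of equal measure, one for each prefix of \<open>n\<close>
  directions leading to \<open>y\<close>, and fixing direction \<open>n\<close> lengthens each
  prefix by one.\<close>

lemma measure_walk_and_direction:
  fixes \<omega> :: "('d::finite) config"
  assumes e: "e \<in> dirs"
  shows "measure driving {\<xi>. walk \<omega> \<xi> n = y \<and> \<xi> n = e} =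
    measure driving {\<xi>. walk \<omega> \<xi> n = y} / (2 * real CARD('d))"
proof -
  interpret D: prob_space "driving :: 'd path measure" by (rule prob_space_driving)
  \<comment> \<open>Prefixes are functions that are \<open>undefined\<close> from \<open>n\<close>
    on; this makes \<open>F\<close> finite and the cylinders of distinct members disjoint.\<close>
  define F where "F = {es \<in> PiE {..<n} (\<lambda>_. dirs). walk \<omega> es n = y}"
  have finF: "finite F" by (simp add: F_def finite_PiE)
  have *: "measure driving {\<xi>. walk \<omega> \<xi> n = y \<and> \<xi> \<in> B} = real (card F) * c"
    if B: "B \<in> sets driving" and c: "\<And>es. es \<in> F \<Longrightarrow> measure driving ({\<xi>. \<forall>i<n. \<xi> i = es i} \<inter> B) = c"
    for B c
  proof -
    have A: "{\<xi>. walk \<omega> \<xi> n = y \<and> \<xi> \<in> B} \<in> sets driving"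
    proof -
      have "{\<xi>. walk \<omega> \<xi> n = y} \<in> sets driving"
        by (rule sets_driving_Collect) measurable
      then show ?thesis using sets.Int[OF _ B] by (simp add: Collect_conj_eq)
    qed
    have pre: "{\<xi>. \<forall>i<n. \<xi> i = es i} \<inter> B \<in> sets driving" for es
    proof -
      have "{\<xi>. \<forall>i<n. \<xi> i = es i} \<in> sets driving"
        by (rule sets_driving_Collect) measurable
      then show ?thesis using B by auto
    qed
    have "measure driving {\<xi>. walk \<omega> \<xi> n = y \<and> \<xi> \<in> B} =
        measure driving (\<Union>es\<in>F. {\<xi>. \<forall>i<n. \<xi> i = es i} \<inter> B)"
    proof (rule D.finite_measure_eq_AE[OF _ A])
      show "AE \<xi> in driving. \<xi> \<in> {\<xi>. walk \<omega> \<xi> n = y \<and> \<xi> \<in> B} \<longleftrightarrow>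
          \<xi> \<in> (\<Union>es\<in>F. {\<xi>. \<forall>i<n. \<xi> i = es i} \<inter> B)"
        using AE_driving_dirs
      proof eventually_elim
        case (elim \<xi>)
        have "walk \<omega> (restrict \<xi> {..<n}) n = walk \<omega> \<xi> n" by (rule walk_cong) simp
        then have "restrict \<xi> {..<n} \<in> F" if "walk \<omega> \<xi> n = y"
          using that elim by (auto simp: F_def)
        moreover have "walk \<omega> \<xi> n = y" if "es \<in> F" "\<forall>i<n. \<xi> i = es i" for es
          using that walk_cong[of n \<xi> es \<omega>] by (auto simp: F_def)
        ultimately show ?case by fastforce
      qed
      show "(\<Union>es\<in>F. {\<xi>. \<forall>i<n. \<xi> i = es i} \<inter> B) \<in> sets driving"
        by (rule sets.finite_UN[OF finF pre])
    qed
    also have "\<dots> = (\<Sum>es\<in>F. measure driving ({\<xi>. \<forall>i<n. \<xi> i = es i} \<inter> B))"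
    proof (rule D.finite_measure_finite_Union[OF finF])
      have "es = es'" if "es \<in> F" "es' \<in> F" "\<forall>i<n. \<xi> i = es i" "\<forall>i<n. \<xi> i = es' i" for es es' \<xi>
        using that unfolding F_def by (intro PiE_ext[of es "{..<n}" "\<lambda>_. dirs" es']) auto
      then show "disjoint_family_on (\<lambda>es. {\<xi>. \<forall>i<n. \<xi> i = es i} \<inter> B) F"
        unfolding disjoint_family_on_def by blast
      show "(\<lambda>es. {\<xi>. \<forall>i<n. \<xi> i = es i} \<inter> B) ` F \<subseteq> sets driving"
        using pre by (rule image_subsetI)
    qed
    finally show ?thesis using c by simp
  qed
  let ?c = "1 / (2 * real CARD('d))"
  have dF: "es i \<in> dirs" if "es \<in> F" "i < n" for es i
    using that by (auto simp: F_def)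
  have "measure driving {\<xi>. walk \<omega> \<xi> n = y \<and> \<xi> \<in> UNIV} = real (card F) * ?c ^ n"
  proof (rule *)
    show "UNIV \<in> sets driving" using sets.top[of driving] by simp
    show "measure driving ({\<xi>. \<forall>i<n. \<xi> i = es i} \<inter> UNIV) = ?c ^ n" if "es \<in> F" for es
      using measure_driving_prefix[of n es] dF[OF that] by simp
  qed
  moreover have "measure driving {\<xi>. walk \<omega> \<xi> n = y \<and> \<xi> \<in> {\<xi>. \<xi> n = e}} = real (card F) * ?c ^ Suc n"
  proof (rule *)
    show "{\<xi>. \<xi> n = e} \<in> sets driving" by (rule sets_driving_Collect) measurable
    fix es assume es: "es \<in> F"
    have "{\<xi>. \<forall>i<n. \<xi> i = es i} \<inter> {\<xi>. \<xi> n = e} = {\<xi>. \<forall>i<Suc n. \<xi> i = (es(n := e)) i}"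
      by (auto simp: less_Suc_eq)
    then show "measure driving ({\<xi>. \<forall>i<n. \<xi> i = es i} \<inter> {\<xi>. \<xi> n = e}) = ?c ^ Suc n"
      using measure_driving_prefix[of "Suc n" "es(n := e)"] dF[OF es] e by simp
  qed
  ultimately show ?thesis by simp
qed

section \<open>Heat kernel and Green function\<close>

definition heat :: "('d::finite) config \<Rightarrow> nat \<Rightarrow> 'd site \<Rightarrow> real" where
  "heat \<omega> n x = measure driving {\<xi>. walk \<omega> \<xi> n = x}"

lemma heat_nonneg [simp]: "heat \<omega> n x \<ge> 0"
  by (simp add: heat_def)

lemma heat_0: "heat \<omega> 0 x = (if x = (0 :: ('d::finite) site) then 1 else 0)"
proof -
  interpret D: prob_space "driving :: 'd path measure" by (rule prob_space_driving)
  show ?thesis using D.prob_space by (auto simp: heat_def)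
qed

text \<open>Splitting on the last direction expresses the left side through the predecessors of
  \<open>x\<close>; by \<open>step_reverse\<close> these are its neighbours. Hence the heat kernel
  evolves by averaging over neighbours, which is the operator behind the energy.\<close>

lemma heat_Suc:
  fixes \<omega> :: "('d::finite) config"
  assumes rec: "line_recurrent \<omega>" and o: "\<omega> 0"
  shows "heat \<omega> (Suc n) x =
    (if x \<in> points \<omega> then (\<Sum>e\<in>dirs. heat \<omega> n (step \<omega> x e)) / (2 * real CARD('d)) else 0)"
proof -
  interpret D: prob_space "driving :: 'd path measure" by (rule prob_space_driving)
  let ?A = "\<lambda>e. {\<xi>. walk \<omega> \<xi> n = step \<omega> x (- e) \<and> \<xi> n = e}"
  have W: "{\<xi>. walk \<omega> \<xi> m = x} \<in> sets driving" for m
    by (rule sets_driving_Collect) measurable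
  have A: "?A e \<in> sets driving" for e
    by (rule sets_driving_Collect) measurable
  show ?thesis
  proof (cases "x \<in> points \<omega>")
    case True
    have "heat \<omega> (Suc n) x = measure driving (\<Union>e\<in>dirs. ?A e)"
      unfolding heat_def
    proof (rule D.finite_measure_eq_AE[OF _ W])
      show "AE \<xi> in driving. \<xi> \<in> {\<xi>. walk \<omega> \<xi> (Suc n) = x} \<longleftrightarrow> \<xi> \<in> (\<Union>e\<in>dirs. ?A e)"
        using AE_driving_dirs
      proof eventually_elim
        case (elim \<xi>)
        have d: "\<xi> n \<in> dirs" "- \<xi> n \<in> dirs" using elim uminus_dirs by auto
        have "walk \<omega> \<xi> n \<in> points \<omega>" using walk_in_points[OF rec o] elim by blast
        then have "step \<omega> (walk \<omega> \<xi> n) (\<xi> n) = x \<longleftrightarrow> walk \<omega> \<xi> n = step \<omega> x (- \<xi> n)"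
          using step_reverse[OF rec _ d(1)] step_reverse[OF rec True d(2)] by auto
        then show ?case using d by auto
      qed
      show "(\<Union>e\<in>dirs. ?A e) \<in> sets driving" using A by auto
    qed
    also have "\<dots> = (\<Sum>e\<in>dirs. measure driving (?A e))"
      using A by (intro D.finite_measure_finite_Union) (auto simp: disjoint_family_on_def)
    also have "\<dots> = (\<Sum>e\<in>dirs. heat \<omega> n (step \<omega> x (- e)) / (2 * real CARD('d)))"
      by (intro sum.cong) (auto simp: heat_def measure_walk_and_direction)
    also have "\<dots> = (\<Sum>e\<in>dirs. heat \<omega> n (step \<omega> x e) / (2 * real CARD('d)))"
      by (rule sum.reindex_bij_witness[of _ uminus uminus]) (auto intro: uminus_dirs)
    finally show ?thesis using True by (simp add: sum_divide_distrib)
  next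
    case False
    have "AE \<xi> in driving. \<xi> \<notin> {\<xi>. walk \<omega> \<xi> (Suc n) = x}"
      using AE_driving_dirs
    proof eventually_elim
      case (elim \<xi>)
      then show ?case using walk_in_points[OF rec o, of \<xi> "Suc n"] False by auto
    qed
    then have "measure driving {\<xi>. walk \<omega> \<xi> (Suc n) = x} = 0"
      by (subst D.prob_eq_0[OF W])
    then show ?thesis using False unfolding heat_def by simp
  qed
qed

lemma heat_outside_points:
  assumes "line_recurrent \<omega>" "\<omega> 0" "x \<notin> points \<omega>"
  shows "heat \<omega> n x = 0"
  using assms by (cases n) (auto simp: heat_0 heat_Suc points_def)

text \<open>By reversal, each step moves the support into finitely many images of the previous one.
  Finiteness makes the energy estimates applicable to the truncated Green function.\<close>

lemma finite_support_heat:
  fixes \<omega> :: "('d::finite) config"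
  assumes rec: "line_recurrent \<omega>" and o: "\<omega> 0"
  shows "finite {x. heat \<omega> n x \<noteq> 0}"
proof (induction n)
  case (Suc n)
  have "{x. heat \<omega> (Suc n) x \<noteq> 0} \<subseteq> (\<Union>e\<in>dirs. (\<lambda>y. step \<omega> y (- e)) ` {x. heat \<omega> n x \<noteq> 0})"
  proof
    fix x assume "x \<in> {x. heat \<omega> (Suc n) x \<noteq> 0}"
    then have x: "x \<in> points \<omega>" "(\<Sum>e\<in>dirs. heat \<omega> n (step \<omega> x e)) \<noteq> 0"
      by (auto simp: heat_Suc[OF rec o] split: if_splits)
    then obtain e where "e \<in> dirs" "heat \<omega> n (step \<omega> x e) \<noteq> 0"
      by (meson sum.neutral)
    then show "x \<in> (\<Union>e\<in>dirs. (\<lambda>y. step \<omega> y (- e)) ` {x. heat \<omega> n x \<noteq> 0})"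
      using step_reverse[OF rec x(1), of e] by force
  qed
  then show ?case
    by (rule finite_subset) (use Suc in auto)
qed (simp add: heat_0)

text \<open>The truncated Green function \<open>g\<close> of the walk satisfies
  \<open>g - P g = heat \<omega> 0 - heat \<omega> N\<close>, so its energy is at most a multiple of \<open>g 0\<close>, while it
  dominates \<open>g\<^sup>2\<close> pointwise.\<close>

lemma green_bounded:
  fixes \<omega> :: "('d::finite) config"
  assumes d: "CARD('d) \<ge> 3" and rec: "line_recurrent \<omega>" and o: "\<omega> 0"
  shows "(\<Sum>n<N. heat \<omega> n v) \<le> 32 * real CARD('d)"
proof -
  define g where "g x = (\<Sum>n<N. heat \<omega> n x)" for x
  let ?F = "{x. g x \<noteq> 0}" and ?d = "2 * real CARD('d)"
  have g0: "g x \<ge> 0" for x by (auto simp: g_def intro: sum_nonneg)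
  have "?F \<subseteq> (\<Union>n<N. {x. heat \<omega> n x \<noteq> 0})"
    by (auto simp: g_def) (meson lessThan_iff sum.neutral)
  then have fin: "finite ?F"
    by (rule finite_subset) (use finite_support_heat[OF rec o] in auto)
  have supp: "?F \<subseteq> points \<omega>"
    using heat_outside_points[OF rec o] unfolding g_def by (blast intro: sum.neutral)
  have lap: "(\<Sum>e\<in>dirs. g x - g (step \<omega> x e)) = ?d * (heat \<omega> 0 x - heat \<omega> N x)" if "x \<in> points \<omega>" for x
  proof -
    have "(\<Sum>e\<in>dirs. g (step \<omega> x e)) = (\<Sum>n<N. \<Sum>e\<in>dirs. heat \<omega> n (step \<omega> x e))"
      unfolding g_def by (rule sum.swap)
    also have "\<dots> = ?d * (\<Sum>n<N. heat \<omega> (Suc n) x)"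
      using that by (simp add: heat_Suc[OF rec o] flip: sum_divide_distrib)
    finally have "(\<Sum>e\<in>dirs. g x - g (step \<omega> x e)) = ?d * (\<Sum>n<N. heat \<omega> n x - heat \<omega> (Suc n) x)"
      by (simp add: sum_subtractf card_dirs g_def algebra_simps)
    also have "(\<Sum>n<N. heat \<omega> n x - heat \<omega> (Suc n) x) = heat \<omega> 0 x - heat \<omega> N x"
      by (rule sum_lessThan_telescope')
    finally show ?thesis .
  qed
  \<comment> \<open>Only the origin survives: \<open>heat \<omega> 0\<close> is the point mass
    there, and the term with \<open>heat \<omega> N\<close> is dropped because of its sign.\<close>
  have "(\<Sum>x\<in>?F. g x * (\<Sum>e\<in>dirs. g x - g (step \<omega> x e))) \<le> (\<Sum>x\<in>?F. if x = 0 then ?d * g 0 else 0)"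
  proof (rule sum_mono)
    fix x assume "x \<in> ?F"
    then have "g x * (\<Sum>e\<in>dirs. g x - g (step \<omega> x e)) = ?d * g x * (heat \<omega> 0 x - heat \<omega> N x)"
      using lap[of x] supp by auto
    also have "\<dots> \<le> ?d * g x * heat \<omega> 0 x"
      using g0 by (intro mult_left_mono) auto
    finally show "g x * (\<Sum>e\<in>dirs. g x - g (step \<omega> x e)) \<le> (if x = 0 then ?d * g 0 else 0)"
      by (simp add: heat_0 split: if_splits)
  qed
  also have "\<dots> \<le> ?d * g 0"
    using fin g0 by simp
  finally have lap_le: "(\<Sum>x\<in>?F. g x * (\<Sum>e\<in>dirs. g x - g (step \<omega> x e))) \<le> ?d * g 0" .
  have sq: "(g x)\<^sup>2 \<le> 16 * ?d * g 0" for x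
    using point_evaluation_le_energy[OF d rec fin supp g0, of x]
      energy_le_laplacian[OF rec fin supp g0] lap_le by linarith
  \<comment> \<open>At the origin \<open>sq\<close> has \<open>g 0\<close> on both sides, and
    cancelling one factor bounds it; inserting this into \<open>sq\<close> then bounds
    \<open>g\<close> at \<open>v\<close>.\<close>
  have g_zero: "g 0 \<le> 16 * ?d"
    using sq[of 0] g0[of 0] by (cases "g 0 = 0") (auto simp: power2_eq_square)
  have "(g v)\<^sup>2 \<le> (16 * ?d)\<^sup>2"
    using order_trans[OF sq[of v] mult_left_mono[OF g_zero, of "16 * ?d"]]
    by (simp add: power2_eq_square)
  then have "g v \<le> 16 * ?d" by (rule power2_le_imp_le) simp
  then show ?thesis by (simp add: g_def)
qed

text \<open>The bound on the Green function makes the probabilities of being at \<open>v\<close>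
  summable in time, so Borel-Cantelli applies; the countably many null sets for the sites are then
  united.\<close>

lemma AE_walk_transient:
  fixes \<omega> :: "('d::finite) config"
  assumes "CARD('d) \<ge> 3" "line_recurrent \<omega>" "\<omega> 0"
  shows "AE \<xi> in driving. transient (walk \<omega> \<xi>)"
proof -
  interpret D: prob_space "driving :: 'd path measure" by (rule prob_space_driving)
  have "AE \<xi> in driving. finite {n. walk \<omega> \<xi> n = v}" for v
  proof -
    let ?A = "\<lambda>n. {\<xi>. walk \<omega> \<xi> n = v}"
    have A: "?A n \<in> sets driving" for n
      by (rule sets_driving_Collect) measurable
    have "summable (\<lambda>n. heat \<omega> n v)"
      using green_bounded[OF assms] by (intro summableI_nonneg_bounded) auto
    then have "AE \<xi> in driving. eventually (\<lambda>n. \<xi> \<in> space driving - ?A n) sequentially"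
      using A by (intro borel_cantelli_AE1) (auto simp: heat_def D.emeasure_eq_measure)
    then show ?thesis
    proof eventually_elim
      case (elim \<xi>)
      then obtain N where N: "\<And>n. n \<ge> N \<Longrightarrow> walk \<omega> \<xi> n \<noteq> v"
        by (auto simp: eventually_sequentially)
      have "{n. walk \<omega> \<xi> n = v} \<subseteq> {..<N}"
        using N by (metis (mono_tags) lessThan_iff mem_Collect_eq not_le subsetI)
      then show ?case by (rule finite_subset) simp
    qed
  qed
  then show ?thesis by (simp add: transient_def AE_all_countable)
qed

text \<open>Finiteness of a set of times means boundedness, which is expressed by countable
  quantifiers over coordinates.\<close>

lemma sets_transient: "{X. transient X} \<in> sets (path_space :: ('d::finite) path measure)"
proof -
  have "transient X \<longleftrightarrow> (\<forall>v. \<exists>N. \<forall>n. n \<ge> N \<longrightarrow> X n \<noteq> v)" for X :: "'d path"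
    unfolding transient_def
    by (simp add: finite_nat_set_iff_bounded) (meson not_le)
  then have "{X. transient X} = {X \<in> space path_space. \<forall>v. \<exists>N. \<forall>n. n \<ge> N \<longrightarrow> X n \<noteq> (v :: 'd site)}"
    by (simp add: space_PiM)
  also have "\<dots> \<in> sets path_space" by measurable
  finally show ?thesis .
qed

section \<open>Recurrence of the point process along lines\<close>

lemma stationary_measure:
  assumes "stationary M T" "A \<in> sets M"
  shows "measure M (T -` A \<inter> space M) = measure M A"
  using assms measure_distr[of T M M A] by (simp add: stationary_def)

text \<open>The unit vectors generate the lattice: invariance extends to integer multiples along
  each axis in both senses, and then to the basis expansion of \<open>x\<close>.\<close>

lemma shift_invariant_imp_constant:
  fixes \<phi> :: "('d::finite) site \<Rightarrow> 'b"
  assumes inv: "\<And>i x. \<phi> (unit_vec i + x) = \<phi> x"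
  shows "\<phi> x = \<phi> 0"
proof -
  have line: "\<phi> (c *s unit_vec i + x) = \<phi> x" for c i x
  proof (induction c rule: int_induct[where k = 0])
    case (step1 c)
    have "(c + 1) *s unit_vec i + x = unit_vec i + (c *s unit_vec i + x)"
      by (simp add: vec_eq_iff algebra_simps)
    then show ?case by (simp only: inv step1)
  next
    case (step2 c)
    have "c *s unit_vec i + x = unit_vec i + ((c - 1) *s unit_vec i + x)"
      by (simp add: vec_eq_iff algebra_simps)
    then have "\<phi> (c *s unit_vec i + x) = \<phi> ((c - 1) *s unit_vec i + x)" by (simp only: inv)
    then show ?case using step2 by simp
  qed simp
  have "\<phi> (\<Sum>i\<in>I. x $ i *s unit_vec i) = \<phi> 0" if "finite I" for I
    using that by induction (simp_all add: line)
  from this[of UNIV] show ?thesis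
    by (simp add: unit_vec_def basis_expansion)
qed

locale ergodic_point_process = prob_space Q
  for Q :: "('d::finite) config measure" +
  assumes sets_Q: "sets Q = sets config_space"
    and stat: "\<And>i. stationary Q (shift (unit_vec i))"
    and erg: "\<And>i. ergodic Q (shift (unit_vec i))"
    and nonempty: "prob {\<omega>. points \<omega> = {}} < 1"
begin

declare sets_Q [measurable_cong]

lemma space_Q [simp]: "space Q = UNIV"
  using sets_eq_imp_space_eq[OF sets_Q] by (simp add: space_PiM)

lemma sets_Collect_Q: "{\<omega> \<in> space config_space. R \<omega>} \<in> sets config_space \<Longrightarrow> {\<omega>. R \<omega>} \<in> events"
  by (subst sets_Q) (simp add: space_PiM)

lemma occupied_event: "{\<omega>. \<omega> x} \<in> events"
  by (rule sets_Collect_Q) measurable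

lemma prob_occupied: "prob {\<omega>. \<omega> x} = prob {\<omega>. \<omega> 0}"
proof (rule shift_invariant_imp_constant[of "\<lambda>x. prob {\<omega>. \<omega> x}"])
  show "prob {\<omega>. \<omega> (unit_vec i + x)} = prob {\<omega>. \<omega> x}" for i x
    using stationary_measure[OF stat occupied_event, of i x] by (simp add: shift_def vimage_def)
qed

text \<open>Were one site almost surely empty, stationarity would make every site so, and by
  countability the whole configuration, against \<open>nonempty\<close>.\<close>

lemma prob_occupied_pos: "prob {\<omega>. \<omega> x} > 0"
proof (rule ccontr)
  assume "\<not> prob {\<omega>. \<omega> x} > 0"
  then have "prob {\<omega>. \<omega> y} = 0" for y
    using prob_occupied[of x] prob_occupied[of y] by (simp add: not_less measure_le_0_iff)
  then have "AE \<omega> in Q. \<not> \<omega> y" for y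
    using prob_eq_0[OF occupied_event[of y]] by simp
  then have "AE \<omega> in Q. \<forall>y. \<not> \<omega> y" by (simp add: AE_all_countable)
  moreover have "{\<omega>. \<forall>y. \<not> \<omega> y} \<in> events" by (rule sets_Collect_Q) measurable
  ultimately have "prob {\<omega>. \<forall>y. \<not> \<omega> y} = 1" by (simp add: prob_eq_1)
  with nonempty show False by (simp add: points_def)
qed

text \<open>The event that a half-line is occupied infinitely often is invariant, and it has
  probability at least \<open>Q (\<omega> 0 = 1) > 0\<close> as a decreasing limit of events containing an event
  \<open>\<omega> x = 1\<close>; hence ergodicity gives it probability one.\<close>

lemma AE_infinitely_often_occupied:
  fixes \<sigma> :: int
  assumes \<sigma>: "\<sigma> * \<sigma> = 1"
  shows "AE \<omega> in Q. \<forall>n. \<exists>k>n. \<omega> (v + (\<sigma> * k) *s unit_vec i)"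
proof -
  \<comment> \<open>Occupation beyond every threshold is invariant exactly, as
    \<open>ergodic\<close> demands; occupation at some \<open>k > 0\<close> in general is not. The
    sign \<open>\<sigma>\<close> selects the half-line.\<close>
  define B where "B = {\<omega>. \<forall>n. \<exists>k>n. \<omega> (v + (\<sigma> * k) *s unit_vec i)}"
  define A where "A n = {\<omega>. \<exists>k>int n. \<omega> (v + (\<sigma> * k) *s unit_vec i)}" for n
  have A: "A n \<in> events" for n
    unfolding A_def by (rule sets_Collect_Q) measurable
  have "B = (\<Inter>n. A n)"
    by (auto simp: A_def B_def) (meson le_less_trans nat_le_iff order_refl)
  then have B: "B \<in> events" using A by auto
  have "(\<lambda>n. prob (A n)) \<longlonglongrightarrow> prob B"
    unfolding \<open>B = (\<Inter>n. A n)\<close>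
  proof (rule finite_Lim_measure_decseq)
    show "range A \<subseteq> events" using A by auto
    show "decseq A"
      by (auto simp: A_def decseq_def) (meson le_less_trans of_nat_le_iff)
  qed
  \<comment> \<open>The first site beyond the threshold \<open>n\<close> is a witness, and
    stationarity makes its occupation probability the same for all \<open>n\<close>.\<close>
  moreover have "prob (A n) \<ge> prob {\<omega>. \<omega> 0}" for n
  proof -
    have "prob {\<omega>. \<omega> (v + (\<sigma> * (int n + 1)) *s unit_vec i)} \<le> prob (A n)"
      using A by (intro finite_measure_mono) (auto simp: A_def intro: exI[of _ "int n + 1"])
    then show ?thesis by (subst (asm) prob_occupied)
  qed
  ultimately have "prob B \<ge> prob {\<omega>. \<omega> 0}"
    by (intro LIMSEQ_le_const) auto
  then have "prob B \<noteq> 0" using prob_occupied_pos[of 0] by linarith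
  moreover have "shift (unit_vec i) -` B \<inter> space Q = B"
  proof -
    \<comment> \<open>As \<open>\<sigma> * \<sigma> = 1\<close>, the shift replaces \<open>k\<close>
      by \<open>k + \<sigma>\<close>; this only moves thresholds, and all of them are quantified
      over.\<close>
    have eq: "unit_vec i + (v + (\<sigma> * k) *s unit_vec i) = v + (\<sigma> * (k + \<sigma>)) *s unit_vec i" for k
      by (simp add: vec_eq_iff algebra_simps \<sigma>)
    have "(\<forall>n. \<exists>k>n. R (k + \<sigma>)) \<longleftrightarrow> (\<forall>n. \<exists>k>n. R k)" for R :: "int \<Rightarrow> bool"
    proof (intro iffI allI)
      fix n assume "\<forall>n. \<exists>k>n. R (k + \<sigma>)"
      then obtain k where "k > n - \<sigma>" "R (k + \<sigma>)" by blast
      then show "\<exists>k>n. R k" by (intro exI[of _ "k + \<sigma>"]) simp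
    next
      fix n assume "\<forall>n. \<exists>k>n. R k"
      then obtain k where "k > n + \<sigma>" "R k" by blast
      then show "\<exists>k>n. R (k + \<sigma>)" by (intro exI[of _ "k - \<sigma>"]) simp
    qed
    then have "\<omega> \<in> shift (unit_vec i) -` B \<longleftrightarrow> \<omega> \<in> B" for \<omega>
      by (simp only: vimage_eq B_def shift_def mem_Collect_eq eq)
    then show ?thesis by (simp add: set_eq_iff)
  qed
  ultimately have "prob B = 1" using erg[of i] B by (auto simp: ergodic_def)
  then show ?thesis using prob_eq_1[OF B] by (simp add: B_def)
qed

text \<open>The threshold 0 in \<open>AE_infinitely_often_occupied\<close>, with both signs and
  every axis, covers all of \<open>dirs\<close>; sites and axes are countable, so a single null set
  suffices.\<close>

lemma AE_line_recurrent: "AE \<omega> in Q. line_recurrent \<omega>"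
proof -
  have "AE \<omega> in Q. \<forall>v i. (\<exists>k>0. \<omega> (v + (1 * k) *s unit_vec i)) \<and> (\<exists>k>0. \<omega> (v + ((-1) * k) *s unit_vec i))"
    unfolding AE_all_countable AE_conj_iff
  proof (intro allI conjI)
    fix v i
    have *: "AE \<omega> in Q. \<exists>k>0. \<omega> (v + (\<sigma> * k) *s unit_vec i)" if "\<sigma> * \<sigma> = 1" for \<sigma>
      using AE_infinitely_often_occupied[OF that, of v i] by eventually_elim auto
    show "AE \<omega> in Q. \<exists>k>0. \<omega> (v + (1 * k) *s unit_vec i)" by (rule *) simp
    show "AE \<omega> in Q. \<exists>k>0. \<omega> (v + ((-1) * k) *s unit_vec i)" by (rule *) simp
  qed
  then show ?thesis
  proof eventually_elim
    case (elim \<omega>)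
    have neg: "v + k *s (- e) = v + ((-1) * k) *s e" for k :: int and v e :: "'d site"
      by (simp add: vec_eq_iff)
    show ?case
      unfolding line_recurrent_def
    proof (intro allI ballI)
      fix v and e :: "'d site" assume "e \<in> dirs"
      then obtain i where "e = unit_vec i \<or> e = - unit_vec i" by (auto simp: dirs_def)
      then have "\<exists>k>0. \<omega> (v + k *s e)"
      proof
        assume "e = unit_vec i"
        then show ?thesis using elim by simp
      next
        assume "e = - unit_vec i"
        then show ?thesis using elim by (simp only: neg)
      qed
      then obtain k where "k > 0" "\<omega> (v + k *s e)" by blast
      then show "\<exists>k>0. \<omega> (v + int k *s e)"
        by (intro exI[of _ "nat k"]) auto
    qed
  qed
qed

section \<open>From the quenched to the annealed law\<close>

text \<open>Conditioning on an occupied origin preserves almost sure line recurrence. For such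
  configurations the quenched law is the walk law and gives the non-transient paths measure zero, so
  their integral over configurations vanishes.\<close>

lemma AE_annealed_transient:
  assumes d: "CARD('d) \<ge> 3"
  shows "AE X in annealed_law Q. transient X"
proof -
  have O: "origin_occupied \<in> events" "prob origin_occupied > 0"
    using occupied_event[of 0] prob_occupied_pos[of 0] by (auto simp: origin_occupied_def)
  have rec: "AE \<omega> in conditioned Q. line_recurrent \<omega> \<and> \<omega> 0"
    unfolding conditioned_def
  proof (rule AE_uniform_measureI[OF O(1)])
    show "AE \<omega> in Q. \<omega> \<in> origin_occupied \<longrightarrow> line_recurrent \<omega> \<and> \<omega> 0"
      using AE_line_recurrent by eventually_elim (simp add: origin_occupied_def)
  qed
  let ?N = "UNIV - {X :: 'd path. transient X}"
  have N: "?N \<in> sets path_space"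
    using sets.compl_sets[OF sets_transient] by (simp add: space_PiM)
  have "emeasure (annealed_law Q) ?N = (\<integral>\<^sup>+\<omega>. emeasure (quenched_law \<omega>) ?N \<partial>conditioned Q)"
    using O(2) by (intro emeasure_annealed_law(1) prob_space_axioms sets_Q rec N)
  also have "\<dots> = (\<integral>\<^sup>+\<omega>. 0 \<partial>conditioned Q)"
  proof (rule nn_integral_cong_AE)
    show "AE \<omega> in conditioned Q. emeasure (quenched_law \<omega>) ?N = 0"
      using rec
    proof eventually_elim
      case (elim \<omega>)
      have "AE X in walk_law \<omega>. transient X"
        unfolding walk_law_def
        using AE_walk_transient[OF d, of \<omega>] elim sets_transient
        by (subst AE_distr_iff) (auto simp: space_PiM)
      then have "emeasure (walk_law \<omega>) ?N = 0"
        using N by (subst (asm) AE_iff_measurable[where N = ?N]) auto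
      then show ?case using elim by (simp add: quenched_law_eq_walk_law)
    qed
  qed
  finally have "emeasure (annealed_law Q) ?N = 0" by simp
  moreover have "sets (annealed_law Q) = sets (path_space :: 'd path measure)"
    "space (annealed_law Q) = UNIV"
    using sets.sigma_sets_eq[of "path_space :: 'd path measure"]
    by (simp_all add: annealed_law_def space_PiM)
  ultimately show ?thesis
    using N by (intro AE_I[of _ _ ?N]) auto
qed

end

theorem theorem1p12:
  fixes Q :: "('d::finite) config measure"
  assumes "CARD('d) \<ge> 3"
    and "prob_space Q" and "sets Q = sets config_space"
    and "\<forall>i. stationary Q (shift (unit_vec i))"
    and "\<forall>i. ergodic Q (shift (unit_vec i))"
    and "measure Q {\<omega>. points \<omega> = {}} < 1"
  shows "AE X in annealed_law Q. transient X"
proof -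
  interpret ergodic_point_process Q
    using assms by (intro ergodic_point_process.intro ergodic_point_process_axioms.intro) blast+
  show ?thesis using assms(1) by (rule AE_annealed_transient)
qed

end
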